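(* For a metric space $(X,d)$, the following are equivalent: (1) $(X,d)$ has a coarse median in the sense of Bowditch; (2) $(X,d)$ has a coarse interval structure with affine parameters; (3) $(X,d)$ has a coarse $1$-median structure that is $(\Lambda,\Psi)$-affine.
   Context: Conventions: $\mathcal{N}_s(A)=\{x: d(x,A)<s\}$ for $s>0$, $\mathcal{N}_0(A)=A$; $d^{\rm H}$ is Hausdorff distance; $\mathrm{diam}(\emptyset)=0$; $\mathcal{P}(X)$ is the power set. Bowditch coarse median: a map $\mu:X^3\to X$ for which there are $k\ge0$ and $h:\mathbb{N}\cup\{0\}\to[0,\infty)$ with: (M1) $d(\mu(a_1,a_2,a_3),\mu(a_1',a_2',a_3'))\le k\sum_{i=1}^3d(a_i,a_i')+h(0)$ for all $a_i,a_i'\in X$; (M2) for every $A\subset X$ with $1\le|A|\le p<\infty$ there are a finite median algebra $(M,\mu_M)$ and maps $i:A\to M$, $\lambda:M\to X$ with $d(a,\lambda(i(a)))\le h(p)$ for all $a\in A$ and $d(\lambda(\mu_M(x,y,z)),\mu(\lambda(x),\lambda(y),\lambda(z)))\le h(p)$ for all $x,y,z\in M$. Coarse interval structure: a map $[\cdot,\cdot]:X^2\to\mathcal{P}(X)$ with parameters $(k_0,k_1,\Phi,\Psi)$ such that: (I1) $k_0\ge0$ and $d^{\rm H}(a,[a,a])\le k_0$, $d^{\rm H}([a,b],[b,a])\le k_0$ for all $a,b$; (I2) $\Phi:[0,\infty)\to[0,\infty)$ is non-decreasing and for all $a,b\in X$, $R\ge0$, $c\in\mathcal{N}_R([a,b])$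 implies $[a,c]\subset\mathcal{N}_{\Phi(R)}([a,b])$; (I3) $k_1\ge0$ and $\mathcal{N}_{k_1}([a,b])\cap\mathcal{N}_{k_1}([c,b])\cap\mathcal{N}_{k_1}([a,c])\ne\emptyset$ for all $a,b,c$; (I4) $\Psi:[k_1,\infty)\to[0,\infty)$ is non-decreasing and $\mathrm{diam}(\mathcal{N}_R([a,b])\cap\mathcal{N}_R([c,b])\cap\mathcal{N}_R([a,c]))\le\Psi(R)$ for all $a,b,c$ and $R\ge k_1$. The parameters are affine if $\Phi$ and $\Psi$ are affine functions. Coarse $1$-filling: a pair $(F,\Lambda)$ with $F=\{F_0:X\to\mathcal{P}(X),F_1:X^2\to\mathcal{P}(X)\}$ and $\Lambda:[0,\infty)\to[0,\infty)$ non-decreasing such that for all $k\in\{0,1\}$ and $a_0,\dots,a_k\in X$: (F0) $d^{\rm H}(a_0,F_0(a_0))\le\Lambda(0)$; (F1) $F_0(a_i)\subseteq\mathcal{N}_{\Lambda(0)}(F_1(a_0,a_1))$ for $i=0,1$; (F2) $d^{\rm H}(F_1(a_0,a_1),F_1(a_1,a_0))\le\Lambda(0)$; (F3) $F_1(a_0,a_0)\subseteq\mathcal{N}_{\Lambda(0)}(F_0(a_0))$; (F4) for $R\ge0$, if $x\in\mathcal{N}_R(F_k(a_0,\dots,a_k))$ then replacing any one entry $a_j$ by $x$ gives $F_k(a_0,\dots,a_{j-1},x,a_{j+1},\dots,a_k)\subseteq\mathcal{N}_{\Lambda(R)}(F_k(a_0,\dots,a_k))$. A triple $(a_0,a_1,a_2)\in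 X^3$ is $(\delta,D)$-generic ($\delta,D\ge0$) if for any non-empty proper subsets $I_1,\dots,I_q\subset\{0,1,2\}$ with $\bigcap_jI_j=\emptyset$ and $\mathrm{diam}\big(\bigcap_j\mathcal{N}_\delta(F_{|I_j|-1}(a_i:i\in I_j))\big)>D$ (indices in increasing order), one has $|I_1|=\dots=|I_q|=2$. A coarse $1$-median structure with parameters $(F,\Lambda,\delta_0,\lambda,\Psi)$: a coarse $1$-filling $(F,\Lambda)$, a constant $\delta_0\ge0$, a non-constant affine $\lambda:[\delta_0,\infty)\to[0,\infty)$ ($\lambda(\delta)=a(\delta-\delta_0)+b$, $a>0,b\ge0$), and $\Psi:[\delta_0,\infty)^2\to[0,\infty)$ non-decreasing in both entries, such that (CM1) for all $a_0,a_1,a_2\in X$, $\mathcal{N}_{\lambda(\delta_0)}(F_1(a_1,a_2))\cap\mathcal{N}_{\lambda(\delta_0)}(F_1(a_0,a_2))\cap\mathcal{N}_{\lambda(\delta_0)}(F_1(a_0,a_1))\ne\emptyset$; (CM2) for all $\delta,D\ge\delta_0$ and every $(\delta,D)$-generic $(a_0,a_1,a_2)$, the same intersection with $\lambda(\delta)$ in place of $\lambda(\delta_0)$ has diameter at most $\Psi(\delta,D)$. It is $(\Lambda,\Psi)$-affine if $\Lambda$ is affine and $\Psi$ is affine in both coordinates, i.e. $\Psi(\delta,D)=B\delta+CD+E$. *)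

theory Defs
  imports "HOL-Analysis.Analysis"
begin

section \<open>Neighbourhoods, Hausdorff distance, diameter\<close>

text \<open>The distance from a point to the empty set is infinite, whereas \<open>infdist x {} = 0\<close>; hence the
  guard \<open>A \<noteq> {}\<close>.\<close>

definition nbhd :: "real \<Rightarrow> 'a::metric_space set \<Rightarrow> 'a set" where
  "nbhd s A = (if s = 0 then A else {x. A \<noteq> {} \<and> infdist x A < s})"

lemma mem_nbhd_iff: "s \<noteq> 0 \<Longrightarrow> x \<in> nbhd s A \<longleftrightarrow> (\<exists>a\<in>A. dist x a < s)"
  by (auto simp: nbhd_def infdist_def cINF_less_iff)

text \<open>Hausdorff distance and diameter take values in \<open>[0,\<infinity>]\<close>, so that sets at infinite Hausdorff
  distance and unbounded sets are treated correctly.  The real-valued \<^const>\<open>diameter\<close> of an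
  unbounded set is unspecified.\<close>

definition hausdorff_distance :: "'a::metric_space set \<Rightarrow> 'a set \<Rightarrow> ennreal" where
  "hausdorff_distance A B = Inf {ennreal r |r. r \<ge> 0 \<and> A \<subseteq> nbhd r B \<and> B \<subseteq> nbhd r A}"

definition ediameter :: "'a::metric_space set \<Rightarrow> ennreal" where
  "ediameter S = (SUP x\<in>S. SUP y\<in>S. ennreal (dist x y))"

lemma ediameter_empty: "ediameter {} = 0"
  by (simp add: ediameter_def bot_ennreal)

lemma ediameter_le_iff:
  "0 \<le> D \<Longrightarrow> ediameter S \<le> ennreal D \<longleftrightarrow> (\<forall>x\<in>S. \<forall>y\<in>S. dist x y \<le> D)"
  by (auto simp: ediameter_def SUP_le_iff)

definition affine_function_on :: "real set \<Rightarrow> (real \<Rightarrow> real) \<Rightarrow> bool" where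
  "affine_function_on S f \<longleftrightarrow> (\<exists>\<alpha> \<beta>. \<forall>x\<in>S. f x = \<alpha> * x + \<beta>)"

section \<open>Coarse medians\<close>

definition median_algebra_on :: "'m set \<Rightarrow> ('m \<Rightarrow> 'm \<Rightarrow> 'm \<Rightarrow> 'm) \<Rightarrow> bool" where
  "median_algebra_on M m \<longleftrightarrow>
     (\<forall>a\<in>M. \<forall>b\<in>M. \<forall>c\<in>M. m a b c \<in> M) \<and>
     (\<forall>a\<in>M. \<forall>b\<in>M. \<forall>c\<in>M. m a b c = m b a c \<and> m a b c = m b c a) \<and>
     (\<forall>a\<in>M. \<forall>b\<in>M. m a a b = a) \<and>
     (\<forall>a\<in>M. \<forall>b\<in>M. \<forall>c\<in>M. \<forall>d\<in>M. \<forall>e\<in>M.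
        m a b (m c d e) = m (m a b c) (m a b d) e)"

text \<open>Every finite median algebra is isomorphic to one whose carrier is a finite set of natural
  numbers, so it suffices to quantify over the latter.\<close>

definition bowditch_coarse_median :: "('a::metric_space \<Rightarrow> 'a \<Rightarrow> 'a \<Rightarrow> 'a) \<Rightarrow> bool" where
  "bowditch_coarse_median \<mu> \<longleftrightarrow>
     (\<exists>(k::real) (h::nat \<Rightarrow> real). k \<ge> 0 \<and> (\<forall>p. h p \<ge> 0) \<and>
        (\<forall>a1 a2 a3 b1 b2 b3.
           dist (\<mu> a1 a2 a3) (\<mu> b1 b2 b3) \<le> k * (dist a1 b1 + dist a2 b2 + dist a3 b3) + h 0) \<and>
        (\<forall>A p. finite A \<and> 1 \<le> card A \<and> card A \<le> p \<longrightarrow>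
           (\<exists>(M::nat set) m (i::'a \<Rightarrow> nat) (l::nat \<Rightarrow> 'a).
              finite M \<and> median_algebra_on M m \<and> i ` A \<subseteq> M \<and>
              (\<forall>a\<in>A. dist a (l (i a)) \<le> h p) \<and>
              (\<forall>x\<in>M. \<forall>y\<in>M. \<forall>z\<in>M. dist (l (m x y z)) (\<mu> (l x) (l y) (l z)) \<le> h p))))"

section \<open>Coarse interval structures\<close>

definition coarse_interval_structure ::
  "('a::metric_space \<Rightarrow> 'a \<Rightarrow> 'a set) \<Rightarrow> real \<Rightarrow> real \<Rightarrow> (real \<Rightarrow> real) \<Rightarrow> (real \<Rightarrow> real) \<Rightarrow> bool" where
  "coarse_interval_structure I k0 k1 \<Phi> \<Psi> \<longleftrightarrow>
     (k0 \<ge> 0 \<and>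
      (\<forall>a. hausdorff_distance {a} (I a a) \<le> ennreal k0) \<and>
      (\<forall>a b. hausdorff_distance (I a b) (I b a) \<le> ennreal k0)) \<and>
     ((\<forall>R\<ge>0. \<Phi> R \<ge> 0) \<and> mono_on {0..} \<Phi> \<and>
      (\<forall>a b c. \<forall>R\<ge>0. c \<in> nbhd R (I a b) \<longrightarrow> I a c \<subseteq> nbhd (\<Phi> R) (I a b))) \<and>
     (k1 \<ge> 0 \<and>
      (\<forall>a b c. nbhd k1 (I a b) \<inter> nbhd k1 (I c b) \<inter> nbhd k1 (I a c) \<noteq> {})) \<and>
     ((\<forall>R\<ge>k1. \<Psi> R \<ge> 0) \<and> mono_on {k1..} \<Psi> \<and>
      (\<forall>a b c. \<forall>R\<ge>k1.
         ediameter (nbhd R (I a b) \<inter> nbhd R (I c b) \<inter> nbhd R (I a c)) \<le> ennreal (\<Psi> R)))"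

definition affine_interval_parameters ::
  "real \<Rightarrow> real \<Rightarrow> (real \<Rightarrow> real) \<Rightarrow> (real \<Rightarrow> real) \<Rightarrow> bool" where
  "affine_interval_parameters k0 k1 \<Phi> \<Psi> \<longleftrightarrow>
     affine_function_on {0..} \<Phi> \<and> affine_function_on {k1..} \<Psi>"

section \<open>Coarse 1-fillings and coarse 1-median structures\<close>

definition coarse_1_filling ::
  "('a::metric_space \<Rightarrow> 'a set) \<Rightarrow> ('a \<Rightarrow> 'a \<Rightarrow> 'a set) \<Rightarrow> (real \<Rightarrow> real) \<Rightarrow> bool" where
  "coarse_1_filling F0 F1 \<Lambda> \<longleftrightarrow>
     (\<forall>R\<ge>0. \<Lambda> R \<ge> 0) \<and> mono_on {0..} \<Lambda> \<and>
     (\<forall>a. hausdorff_distance {a} (F0 a) \<le> ennreal (\<Lambda> 0)) \<and>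
     (\<forall>a b. F0 a \<subseteq> nbhd (\<Lambda> 0) (F1 a b) \<and> F0 b \<subseteq> nbhd (\<Lambda> 0) (F1 a b)) \<and>
     (\<forall>a b. hausdorff_distance (F1 a b) (F1 b a) \<le> ennreal (\<Lambda> 0)) \<and>
     (\<forall>a. F1 a a \<subseteq> nbhd (\<Lambda> 0) (F0 a)) \<and>
     (\<forall>R\<ge>0. \<forall>a x. x \<in> nbhd R (F0 a) \<longrightarrow> F0 x \<subseteq> nbhd (\<Lambda> R) (F0 a)) \<and>
     (\<forall>R\<ge>0. \<forall>a b x. x \<in> nbhd R (F1 a b) \<longrightarrow>
        F1 x b \<subseteq> nbhd (\<Lambda> R) (F1 a b) \<and> F1 a x \<subseteq> nbhd (\<Lambda> R) (F1 a b))"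

text \<open>\<open>face_filling F0 F1 as I\<close> is \<open>F\<^bsub>|I|-1\<^esub>(a\<^sub>i : i \<in> I)\<close> with the indices in increasing order, for
  \<open>|I| \<in> {1,2}\<close>.\<close>

definition face_filling ::
  "('a \<Rightarrow> 'a set) \<Rightarrow> ('a \<Rightarrow> 'a \<Rightarrow> 'a set) \<Rightarrow> 'a list \<Rightarrow> nat set \<Rightarrow> 'a set" where
  "face_filling F0 F1 as I =
     (case map (\<lambda>i. as ! i) (sorted_list_of_set I) of
        [x] \<Rightarrow> F0 x
      | [x, y] \<Rightarrow> F1 x y
      | _ \<Rightarrow> {})"

definition generic_triple ::
  "('a::metric_space \<Rightarrow> 'a set) \<Rightarrow> ('a \<Rightarrow> 'a \<Rightarrow> 'a set) \<Rightarrow> real \<Rightarrow> real \<Rightarrow> 'a \<Rightarrow> 'a \<Rightarrow> 'a \<Rightarrow> bool" where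
  "generic_triple F0 F1 \<delta> D a0 a1 a2 \<longleftrightarrow>
     (\<forall>(q::nat) (I::nat \<Rightarrow> nat set).
        q \<ge> 1 \<and>
        (\<forall>j\<in>{1..q}. I j \<noteq> {} \<and> I j \<subset> {0, 1, 2}) \<and>
        (\<Inter>j\<in>{1..q}. I j) = {} \<and>
        ediameter (\<Inter>j\<in>{1..q}. nbhd \<delta> (face_filling F0 F1 [a0, a1, a2] (I j))) > ennreal D
        \<longrightarrow> (\<forall>j\<in>{1..q}. card (I j) = 2))"

definition coarse_1_median_structure ::
  "('a::metric_space \<Rightarrow> 'a set) \<Rightarrow> ('a \<Rightarrow> 'a \<Rightarrow> 'a set) \<Rightarrow> (real \<Rightarrow> real) \<Rightarrow>
   real \<Rightarrow> (real \<Rightarrow> real) \<Rightarrow> (real \<Rightarrow> real \<Rightarrow> real) \<Rightarrow> bool" where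
  "coarse_1_median_structure F0 F1 \<Lambda> \<delta>0 lam \<Psi> \<longleftrightarrow>
     coarse_1_filling F0 F1 \<Lambda> \<and>
     \<delta>0 \<ge> 0 \<and>
     (\<exists>a b. a > 0 \<and> b \<ge> 0 \<and> (\<forall>\<delta>\<ge>\<delta>0. lam \<delta> = a * (\<delta> - \<delta>0) + b)) \<and>
     (\<forall>\<delta>\<ge>\<delta>0. \<forall>D\<ge>\<delta>0. \<Psi> \<delta> D \<ge> 0) \<and>
     (\<forall>D\<ge>\<delta>0. mono_on {\<delta>0..} (\<lambda>\<delta>. \<Psi> \<delta> D)) \<and>
     (\<forall>\<delta>\<ge>\<delta>0. mono_on {\<delta>0..} (\<lambda>D. \<Psi> \<delta> D)) \<and>
     (\<forall>a0 a1 a2. nbhd (lam \<delta>0) (F1 a1 a2) \<inter> nbhd (lam \<delta>0) (F1 a0 a2) \<inter> nbhd (lam \<delta>0) (F1 a0 a1)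
        \<noteq> {}) \<and>
     (\<forall>\<delta>\<ge>\<delta>0. \<forall>D\<ge>\<delta>0. \<forall>a0 a1 a2. generic_triple F0 F1 \<delta> D a0 a1 a2 \<longrightarrow>
        ediameter (nbhd (lam \<delta>) (F1 a1 a2) \<inter> nbhd (lam \<delta>) (F1 a0 a2) \<inter> nbhd (lam \<delta>) (F1 a0 a1))
          \<le> ennreal (\<Psi> \<delta> D))"

definition affine_1_median_parameters ::
  "(real \<Rightarrow> real) \<Rightarrow> real \<Rightarrow> (real \<Rightarrow> real \<Rightarrow> real) \<Rightarrow> bool" where
  "affine_1_median_parameters \<Lambda> \<delta>0 \<Psi> \<longleftrightarrow>
     affine_function_on {0..} \<Lambda> \<and>
     (\<exists>B C E. \<forall>\<delta>\<ge>\<delta>0. \<forall>D\<ge>\<delta>0. \<Psi> \<delta> D = B * \<delta> + C * D + E)"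

end

theory Submission
  imports Defs
begin

text \<open>Intervals to medians: points of \<open>X\<close> are replaced by families \<open>'t \<Rightarrow> X\<close> and equality by bounded
  distance.  The coarse interval axioms then become Sholander's exact axioms for betweenness in a
  median algebra, so halfspaces separate non-equivalent families.  Take the valuations of \<open>p\<close>
  variables as index set.  The families generated by the \<open>p\<close> coordinate projections are distinguished
  by the halfspaces' traces on these projections, so they form a finite median algebra modulo bounded
  distance.  Evaluating representatives at a given valuation gives the approximations (M2), with
  constants that depend only on \<open>p\<close>.

  Medians to 1-medians: (M2) for four points gives the four-point identity up to a constant, from which
  \<open>F\<^sub>0(a) = {a}\<close> and \<open>F\<^sub>1(a,b) = {\<mu>(a,b,x) | x}\<close> satisfy all axioms, (CM2) even for non-generic triples.

  1-medians to intervals: \<open>[a,b] = F\<^sub>1(a,b)\<close> works because every triple is \<open>(\<delta>,D)\<close>-generic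
  as soon as \<open>D \<ge> 2(\<delta> + \<Lambda>(0) + 1)\<close>.\<close>

section \<open>Betweenness and halfspaces\<close>

text \<open>Equality of points is only used up to the equivalence \<^term>\<open>btw x y x\<close>, i.e. \<open>y \<in> [x,x]\<close>.\<close>

locale betweenness =
  fixes btw :: "'x \<Rightarrow> 'x \<Rightarrow> 'x \<Rightarrow> bool" and m :: "'x \<Rightarrow> 'x \<Rightarrow> 'x \<Rightarrow> 'x"
  assumes btw_left: "btw a a b"
    and btw_sym: "btw a x b \<Longrightarrow> btw b x a"
    and btw_trans: "btw a x b \<Longrightarrow> btw a y x \<Longrightarrow> btw a y b"
    and med12: "btw a (m a b c) b"
    and med23: "btw b (m a b c) c"
    and med13: "btw a (m a b c) c"
    and btw_unique: "\<lbrakk>btw a x b; btw b x c; btw a x c; btw a y b; btw b y c; btw a y c\<rbrakk> \<Longrightarrow> btw x y x"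
begin

section \<open>Betweenness up to equivalence: meets, gates and the Peano property\<close>

lemma btw_right: "btw a b b"
  using btw_left btw_sym by blast

lemma equiv_sym: "btw x y x \<Longrightarrow> btw y x y"
  using btw_left btw_unique by blast

lemma btw_cong: "btw a x b \<Longrightarrow> btw x y x \<Longrightarrow> btw a y b"
  using btw_left btw_sym btw_trans by meson

lemma equiv_trans: "btw x y x \<Longrightarrow> btw y z y \<Longrightarrow> btw x z x"
  using btw_cong by blast

lemma btw_trans': "btw a x b \<Longrightarrow> btw x y b \<Longrightarrow> btw a y b"
  using btw_sym btw_trans by blast

text \<open>Both \<open>x\<close> and \<open>y\<close> are medians of \<open>u\<close>,
  \<open>x\<close>, \<open>y\<close>.\<close>

lemma btw_antisym: "btw u x y \<Longrightarrow> btw u y x \<Longrightarrow> btw x y x"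
  using btw_right btw_left btw_sym btw_unique by meson

text \<open>By transitivity \<open>v\<close> also lies between \<open>y\<close> and
  \<open>z\<close>, so \<open>u\<close> and \<open>v\<close> are both medians of \<open>u\<close>,
  \<open>y\<close>, \<open>z\<close>.\<close>

lemma equiv_if_below_both:
  assumes "btw y u z" "btw u v y" "btw u v z"
  shows "btw u v u"
  by (meson assms btw_left btw_right btw_sym btw_trans btw_unique)

text \<open>In the order rooted at \<open>b\<close>, where \<open>x\<close> is below
  \<open>y\<close> if \<open>btw b x y\<close>, the median \<open>m b c d\<close> is the meet of
  \<open>c\<close> and \<open>d\<close>. The point \<open>m n c d\<close> is a second median of
  \<open>b\<close>, \<open>c\<close>, \<open>d\<close>, which places the meet between
  \<open>n\<close> and \<open>c\<close>.\<close>

lemma meet_greatest: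
  assumes c: "btw b n c" and d: "btw b n d"
  shows "btw b n (m b c d)"
proof -
  let ?p = "m b c d" and ?s = "m n c d"
  have "btw b ?s c" "btw b ?s d" "btw c ?s d"
    using med12[of n c d] med13[of n c d] med23 c d btw_trans' by blast+
  then have ps: "btw ?s ?p ?s"
    using btw_unique[of b ?s c d] med12[of b c d] med13[of b d c] med23[of c b d] med13 by blast
  then have pc: "btw n ?p c"
    using btw_cong med12 by blast
  \<comment> \<open>A device that recurs below: to put \<open>n\<close> between \<open>b\<close> and
    \<open>?p\<close>, the median of the three points is shown to be equivalent to
    \<open>n\<close>.\<close>
  let ?t = "m n b ?p"
  have "btw n ?t c"
    using btw_trans[OF pc] med13 by blast
  moreover have "btw n ?t b"
    by (rule med12)
  ultimately have "btw n ?t n"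
    using equiv_if_below_both[of b n c] c by blast
  then show ?thesis
    using btw_cong equiv_sym med23 by blast
qed

text \<open>The median of \<open>y\<close>, \<open>a\<close>, \<open>s\<close> lies between
  \<open>y\<close> and each of \<open>a\<close> and \<open>b\<close>, hence is equivalent to
  \<open>y\<close>.\<close>

lemma btw_reverse:
  assumes "btw b s y" "btw a y b"
  shows "btw a y s"
proof -
  let ?t = "m y a s"
  have "btw y ?t a" "btw y ?t b"
    using assms btw_sym btw_trans med12 med13 by blast+
  then have "btw y ?t y"
    using assms equiv_if_below_both by blast
  then show ?thesis
    using btw_cong equiv_sym med23 by blast
qed

text \<open>The point \<open>m x a b\<close> is the gate of \<open>x\<close> in the interval between \<open>a\<close> and \<open>b\<close>.\<close>

lemma gate:
  assumes y: "btw a y b"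
  shows "btw x (m x a b) y"
proof -
  let ?s = "m x a y" and ?s' = "m x b y"
  \<comment> \<open>\<open>?t\<close> turns out to be a second median of \<open>x\<close>,
    \<open>a\<close>, \<open>b\<close>, and it lies between \<open>x\<close> and \<open>y\<close> by
    construction.\<close>
  let ?t = "m x ?s ?s'"
  have ys': "btw a y ?s'"
    using btw_reverse med23 y by blast
  have s: "btw a ?s ?s'"
    using btw_trans[OF ys'] med23 by blast
  have s': "btw a ?s' b"
    using btw_trans' y btw_sym med23 by meson
  have "btw a ?t ?s'"
    using btw_trans'[OF s] med23 by blast
  then have tab: "btw a ?t b"
    using s' btw_trans by blast
  have txa: "btw x ?t a" and txy: "btw x ?t y"
    using btw_trans[of x ?s] med12[of x ?s ?s'] med12[of x a y] med13[of x a y] by blast+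
  have txb: "btw x ?t b"
    using btw_trans[of x ?s'] med13[of x ?s ?s'] med12[of x b y] by blast
  have "btw ?t (m x a b) ?t"
    using btw_unique[of x ?t a b] txa txb tab med12[of x a b] med13[of x b a] med23[of a x b] med13
    by blast
  then show ?thesis
    using btw_cong txy by blast
qed

text \<open>The gate of \<open>u\<close> in the interval from \<open>a\<close> to \<open>b\<close>
  lies between \<open>u\<close> and each of \<open>y\<close> and \<open>z\<close>. As
  \<open>u\<close> lies between \<open>y\<close> and \<open>z\<close>, the gate is equivalent to
  \<open>u\<close>.\<close>

lemma btw_convex:
  assumes "btw a y b" "btw a z b" "btw y u z"
  shows "btw a u b"
proof -
  have "btw u (m u a b) u"
    using gate[OF assms(1)] gate[OF assms(2)] equiv_if_below_both[OF assms(3)] by blast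
  then show ?thesis
    using btw_cong equiv_sym med23 by blast
qed

text \<open>The Peano axiom of convexity for the triangle \<open>c\<close>, \<open>x\<close>,
  \<open>v\<close>, with an explicit point \<open>m c v w\<close> on the side from \<open>c\<close>
  to \<open>v\<close>.\<close>

lemma peano:
  assumes u: "btw c u x" and w: "btw u w v"
  shows "btw (m c v w) w x"
proof -
  let ?y = "m c v w"
  let ?t = "m w ?y x"
  have "btw w ?t c" "btw w ?t v"
    using btw_trans[of w ?y] med12[of w ?y x] med13[of c v w] med23[of v c w] btw_sym by blast+
  \<comment> \<open>In the order rooted at \<open>w\<close>, \<open>?t\<close> is below both
    \<open>c\<close> and \<open>x\<close>, hence below \<open>m w c x\<close>. This is the gate of
    \<open>w\<close> in the interval from \<open>c\<close> to \<open>x\<close>, so it lies between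
    \<open>w\<close> and \<open>u\<close>.\<close>
  moreover have "btw w ?t (m w c x)"
    using meet_greatest calculation(1) med13 by blast
  then have "btw w ?t u"
    using btw_trans gate[OF u] by blast
  ultimately have "btw w ?t w"
    using equiv_if_below_both w by blast
  then show ?thesis
    using btw_cong equiv_sym med23 by blast
qed

definition convex_set :: "'x set \<Rightarrow> bool" where
  "convex_set C \<longleftrightarrow> (\<forall>x\<in>C. \<forall>y\<in>C. \<forall>z. btw x z y \<longrightarrow> z \<in> C)"

definition halfspace :: "'x set \<Rightarrow> bool" where
  "halfspace H \<longleftrightarrow> convex_set H \<and> convex_set (- H)"

lemma convex_setD: "convex_set C \<Longrightarrow> x \<in> C \<Longrightarrow> y \<in> C \<Longrightarrow> btw x z y \<Longrightarrow> z \<in> C"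
  unfolding convex_set_def by blast

text \<open>The Peano property is applied twice. First \<open>w\<close> is seen from
  \<open>x\<close> in front of a point between \<open>c\<close> and \<open>v\<close>; then that
  point is seen from \<open>x\<close> in front of a point between \<open>c'\<close> and
  \<open>c\<close>, which belongs to \<open>C\<close>.\<close>

lemma convex_join:
  assumes C: "convex_set C"
  shows "convex_set {w. \<exists>c\<in>C. btw c w x}"
  unfolding convex_set_def
proof (safe)
  fix u v w c c'
  assume c: "c \<in> C" "c' \<in> C" and u: "btw c u x" and v: "btw c' v x" and w: "btw u w v"
  let ?y = "m c v w"
  have wy: "btw ?y w x"
    using peano[OF u w] .
  have "btw (m c' c ?y) ?y x"
    by (rule peano[OF v btw_sym[OF med12]])
  moreover have "m c' c ?y \<in> C"
    by (rule convex_setD[OF C c(2,1) med12])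
  ultimately show "\<exists>c\<in>C. btw c w x"
    using btw_trans'[OF _ wy] by blast
qed

text \<open>A convex set that is maximal among those containing \<open>a\<close> and missing
  \<open>b\<close> has a convex complement.\<close>

lemma halfspace_separation:
  assumes ab: "\<not> btw a b a"
  shows "\<exists>H. halfspace H \<and> a \<in> H \<and> b \<notin> H"
proof -
  let ?F = "{C. convex_set C \<and> a \<in> C \<and> b \<notin> C}"
  have "convex_set {x. btw a x a}"
    unfolding convex_set_def by (blast intro: btw_convex)
  then have ne: "{x. btw a x a} \<in> ?F"
    using ab btw_left by auto
  have "\<exists>C\<in>?F. \<forall>D\<in>?F. C \<subseteq> D \<longrightarrow> D = C"
  proof (rule subset_Zorn_nonempty)
    show "?F \<noteq> {}"
      using ne by blast
    fix \<C> assume "\<C> \<noteq> {}" and ch: "subset.chain ?F \<C>"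
    moreover have "convex_set (\<Union>\<C>)"
      unfolding convex_set_def
    proof (safe)
      fix x y z X Y assume *: "x \<in> X" "X \<in> \<C>" "y \<in> Y" "Y \<in> \<C>" "btw x z y"
      then have "X \<subseteq> Y \<or> Y \<subseteq> X" "convex_set X" "convex_set Y"
        using ch by (auto simp: subset.chain_def)
      then show "z \<in> \<Union>\<C>"
        using * convex_setD by (meson UnionI subsetD)
    qed
    ultimately show "\<Union>\<C> \<in> ?F"
      by (auto simp: subset.chain_def)
  qed
  then obtain C where C: "convex_set C" "a \<in> C" "b \<notin> C"
    and max: "\<And>D. convex_set D \<Longrightarrow> a \<in> D \<Longrightarrow> b \<notin> D \<Longrightarrow> C \<subseteq> D \<Longrightarrow> D = C"
    by auto
  \<comment> \<open>By maximality, the join of \<open>C\<close> with an outside point must contain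
    \<open>b\<close>.\<close>
  have join: "\<exists>c\<in>C. btw c b x" if "x \<notin> C" for x
  proof (rule ccontr)
    let ?D = "{w. \<exists>c\<in>C. btw c w x}"
    assume "\<not> (\<exists>c\<in>C. btw c b x)"
    moreover have "C \<subseteq> ?D"
      using btw_left by auto
    ultimately have "?D = C"
      using max[OF convex_join[OF C(1)]] C(2) by blast
    then show False
      using that C(2) btw_right by blast
  qed
  have "convex_set (- C)"
    unfolding convex_set_def
  proof (safe)
    fix x y z assume x: "x \<notin> C" and y: "y \<notin> C" and z: "btw x z y" "z \<in> C"
    obtain c1 c2 where c1: "c1 \<in> C" "btw c1 b x" and c2: "c2 \<in> C" "btw c2 b y"
      using join x y by blast
    \<comment> \<open>This point of \<open>C\<close> lies between \<open>b\<close> and each of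
      \<open>c1\<close>, \<open>c2\<close>, \<open>z\<close>. Hence \<open>b\<close> lies between
      \<open>?c\<close> and both \<open>x\<close> and \<open>y\<close>, and therefore between
      \<open>?c\<close> and \<open>z\<close>. Antisymmetry makes \<open>b\<close> equivalent to
      \<open>?c\<close>, which forces \<open>b\<close> into \<open>C\<close>.\<close>
    let ?c = "m b (m b c1 c2) z"
    have c: "?c \<in> C"
      using convex_setD[OF C(1)] c1(1) c2(1) z(2) med23 by meson
    have "btw b ?c c1" "btw b ?c c2" and cz: "btw b ?c z"
      using btw_trans med12 med13 by blast+
    then have "btw ?c b x" "btw ?c b y"
      using c1(2) c2(2) btw_reverse btw_sym by meson+
    then have "btw ?c b (m ?c x y)"
      using meet_greatest by blast
    then have "btw ?c b z"
      using btw_trans gate[OF z(1)] by blast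
    then have "btw ?c b ?c"
      using cz btw_antisym btw_sym by blast
    then show False
      using C c convex_setD by blast
  qed
  then show ?thesis
    using C halfspace_def by blast
qed

text \<open>Two arguments in a convex set force the median into it; this applies to \<open>H\<close>
  and to its complement.\<close>

lemma halfspace_majority:
  assumes "halfspace H"
  shows "m x y z \<in> H \<longleftrightarrow> x \<in> H \<and> y \<in> H \<or> y \<in> H \<and> z \<in> H \<or> x \<in> H \<and> z \<in> H"
proof -
  have "m x y z \<in> H" if "x \<in> H \<and> y \<in> H \<or> y \<in> H \<and> z \<in> H \<or> x \<in> H \<and> z \<in> H" "convex_set H" for H
    using that convex_setD[OF that(2)] med12 med13 med23 by meson
  from this[of H] this[of "- H"] show ?thesis
    using assms by (auto simp: halfspace_def)
qed

lemma equiv_iff_halfspaces: "btw x y x \<longleftrightarrow> (\<forall>H. halfspace H \<longrightarrow> (x \<in> H \<longleftrightarrow> y \<in> H))"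
proof
  assume xy: "btw x y x"
  have "y \<in> H" if "convex_set H" "x \<in> H" for H
    using convex_setD[OF that(1) that(2) that(2) xy] .
  then show "\<forall>H. halfspace H \<longrightarrow> (x \<in> H \<longleftrightarrow> y \<in> H)"
    unfolding halfspace_def by blast
qed (use halfspace_separation in blast)

text \<open>Halfspaces turn \<open>m\<close> into Boolean majority, so each identity becomes a
  propositional tautology.\<close>

lemma median_identities:
  "btw (m a b c) (m b a c) (m a b c)" "btw (m a b c) (m b c a) (m a b c)" "btw (m a a b) a (m a a b)"
  "btw (m a b (m c d e)) (m (m a b c) (m a b d) e) (m a b (m c d e))"
  by (auto simp: equiv_iff_halfspaces halfspace_majority)

lemma med_cong:
  "btw x x' x \<Longrightarrow> btw y y' y \<Longrightarrow> btw z z' z \<Longrightarrow> btw (m x y z) (m x' y' z') (m x y z)"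
  by (simp add: equiv_iff_halfspaces halfspace_majority)

section \<open>Finite median algebras generated by finitely many points\<close>

inductive_set gen :: "'x set \<Rightarrow> 'x set" for G where
  base: "g \<in> G \<Longrightarrow> g \<in> gen G"
| med: "x \<in> gen G \<Longrightarrow> y \<in> gen G \<Longrightarrow> z \<in> gen G \<Longrightarrow> m x y z \<in> gen G"

text \<open>Whether a generated point lies in a halfspace is a majority expression in the
  memberships of the generators.\<close>

lemma halfspace_trace:
  assumes "x \<in> gen G" "halfspace H" "halfspace K" "H \<inter> G = K \<inter> G"
  shows "x \<in> H \<longleftrightarrow> x \<in> K"
  using assms(1) by induction (use assms(2-) in \<open>auto simp: halfspace_majority\<close>)

text \<open>A point of \<^term>\<open>gen G\<close> is determined, up to equivalence, by the traces on \<^term>\<open>G\<close> of the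
  halfspaces containing it.\<close>

lemma finite_representatives:
  assumes "finite G"
  shows "\<exists>r. finite (r ` gen G) \<and> r ` gen G \<subseteq> gen G \<and> (\<forall>x\<in>gen G. btw x (r x) x) \<and>
           (\<forall>x\<in>gen G. \<forall>y\<in>gen G. btw x y x \<longrightarrow> r x = r y)"
proof -
  define tr where "tr x = {H \<inter> G |H. halfspace H \<and> x \<in> H}" for x
  \<comment> \<open>The choice depends only on \<open>tr x\<close>, so \<open>r\<close> takes
    finitely many values and agrees on equivalent points.\<close>
  define r where "r x = (SOME y. y \<in> gen G \<and> tr y = tr x)" for x
  have r: "r x \<in> gen G \<and> tr (r x) = tr x" if "x \<in> gen G" for x
    unfolding r_def by (rule someI[where P = "\<lambda>y. y \<in> gen G \<and> tr y = tr x" and x = x]) (simp add: that)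
  have eq: "btw x y x" if "x \<in> gen G" "y \<in> gen G" "tr x = tr y" for x y
    unfolding equiv_iff_halfspaces
  proof (intro allI impI)
    fix H assume H: "halfspace H"
    have "b \<in> H" if ab: "a \<in> H" "tr a = tr b" "b \<in> gen G" for a b
    proof -
      obtain K where "halfspace K" "b \<in> K" "H \<inter> G = K \<inter> G"
        using ab H unfolding tr_def by blast
      then show ?thesis
        using halfspace_trace[OF ab(3) H] by blast
    qed
    then show "x \<in> H \<longleftrightarrow> y \<in> H"
      using that by metis
  qed
  have "tr ` gen G \<subseteq> Pow (Pow G)"
    by (auto simp: tr_def)
  then have "finite (tr ` gen G)"
    using assms by (meson finite_Pow_iff finite_subset)
  then have "finite ((\<lambda>t. SOME y. y \<in> gen G \<and> tr y = t) ` tr ` gen G)"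
    by (rule finite_imageI)
  then have "finite (r ` gen G)"
    by (simp add: image_image r_def)
  moreover have "tr x = tr y" if "btw x y x" for x y
    using that by (auto simp: tr_def equiv_iff_halfspaces)
  then have "r x = r y" if "btw x y x" for x y
    using that unfolding r_def by simp
  ultimately show ?thesis
    using r eq by (intro exI[of _ r]) auto
qed

text \<open>\<open>enc\<close> codes representatives by natural numbers and identifies equivalent
  points, so identities valid up to equivalence become equalities in \<open>M\<close>.\<close>

lemma finite_median_model:
  assumes "finite G"
  shows "\<exists>(M::nat set) mm enc dec. finite M \<and> median_algebra_on M mm \<and> enc ` gen G \<subseteq> M \<and>
           (\<forall>x\<in>gen G. btw x (dec (enc x)) x) \<and>
           (\<forall>x\<in>M. \<forall>y\<in>M. \<forall>z\<in>M.
              btw (dec (mm x y z)) (m (dec x) (dec y) (dec z)) (dec (mm x y z)))"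
proof -
  obtain r where fin: "finite (r ` gen G)" and sub: "r ` gen G \<subseteq> gen G"
    and r: "\<And>x. x \<in> gen G \<Longrightarrow> btw x (r x) x"
    and eq: "\<And>x y. x \<in> gen G \<Longrightarrow> y \<in> gen G \<Longrightarrow> btw x y x \<Longrightarrow> r x = r y"
    using finite_representatives[OF assms] by auto
  define enc where "enc x = to_nat_on (r ` gen G) (r x)" for x
  define dec where "dec = from_nat_into (r ` gen G)"
  define M where "M = enc ` gen G"
  define mm where "mm x y z = enc (m (dec x) (dec y) (dec z))" for x y z
  have dec_enc: "dec (enc x) = r x" if "x \<in> gen G" for x
    unfolding dec_def enc_def using fin that
    by (intro from_nat_into_to_nat_on) (auto intro: countable_finite)
  have enc_eq: "enc x = enc y" if "x \<in> gen G" "y \<in> gen G" "btw x y x" for x y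
    using eq[OF that] by (simp add: enc_def)
  have gen: "dec x \<in> gen G" "enc (dec x) = x" if "x \<in> M" for x
  proof -
    obtain g where g: "g \<in> gen G" "x = enc g"
      using \<open>x \<in> M\<close> unfolding M_def by blast
    then show "dec x \<in> gen G"
      using sub dec_enc by auto
    then show "enc (dec x) = x"
      using enc_eq[OF g(1) _ r[OF g(1)]] g(2) dec_enc[OF g(1)] by metis
  qed
  have mm_M: "mm x y z \<in> M" if "x \<in> M" "y \<in> M" "z \<in> M" for x y z
    unfolding mm_def M_def using gen that by (intro imageI gen.med)
  have mm: "btw (dec (mm x y z)) (m (dec x) (dec y) (dec z)) (dec (mm x y z))"
    if "x \<in> M" "y \<in> M" "z \<in> M" for x y z
  proof -
    have "m (dec x) (dec y) (dec z) \<in> gen G"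
      using gen that by (intro gen.med)
    then show ?thesis
      unfolding mm_def using dec_enc r equiv_sym by simp
  qed
  have "median_algebra_on M mm"
    unfolding median_algebra_on_def
  proof (intro conjI ballI)
    fix a b c assume M: "a \<in> M" "b \<in> M" "c \<in> M"
    show "mm a b c \<in> M"
      by (rule mm_M[OF M])
    show "mm a b c = mm b a c" "mm a b c = mm b c a"
      unfolding mm_def by (rule enc_eq; use M gen median_identities in \<open>blast intro: gen.med\<close>)+
  next
    fix a b assume M: "a \<in> M" "b \<in> M"
    have "enc (m (dec a) (dec a) (dec b)) = enc (dec a)"
      by (rule enc_eq; use M gen median_identities in \<open>blast intro: gen.med\<close>)
    then show "mm a a b = a"
      using M gen unfolding mm_def by simp
  next
    fix a b c d e assume M: "a \<in> M" "b \<in> M" "c \<in> M" "d \<in> M" "e \<in> M"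
    \<comment> \<open>Inner medians are replaced by representatives when they are encoded;
      congruence of \<open>m\<close> undoes this before the identity is applied.\<close>
    let ?m = "\<lambda>x y z. m (dec x) (dec y) (dec z)"
    have "btw (?m a b (mm c d e)) (m (dec a) (dec b) (?m c d e)) (?m a b (mm c d e))"
      using M mm btw_left by (intro med_cong) auto
    moreover have "btw (m (?m a b c) (?m a b d) (dec e)) (?m (mm a b c) (mm a b d) e)
        (m (?m a b c) (?m a b d) (dec e))"
      using M mm equiv_sym btw_left by (intro med_cong) auto
    ultimately have "btw (?m a b (mm c d e)) (?m (mm a b c) (mm a b d) e) (?m a b (mm c d e))"
      using median_identities(4) equiv_trans by meson
    then show "mm a b (mm c d e) = mm (mm a b c) (mm a b d) e"
      unfolding mm_def[of a b "mm c d e"] mm_def[of "mm a b c" "mm a b d" e]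
      using M mm_M gen by (intro enc_eq gen.med) auto
  qed
  moreover have "finite M"
    unfolding M_def enc_def by (metis fin finite_imageI image_image)
  moreover have "\<forall>x\<in>gen G. btw x (dec (enc x)) x"
    using dec_enc r by simp
  ultimately show ?thesis
    using mm M_def by (intro exI[of _ M] exI[of _ mm] exI[of _ enc] exI[of _ dec]) auto
qed

end

section \<open>From coarse intervals to coarse medians\<close>

lemma nbhdD: "x \<in> nbhd s A \<Longrightarrow> 0 \<le> s \<Longrightarrow> \<exists>a\<in>A. dist x a \<le> s"
  using mem_nbhd_iff[of s x A] less_imp_le by (cases "s = 0") (auto simp: nbhd_def[of 0])

lemma nbhdI: "a \<in> A \<Longrightarrow> dist x a \<le> r \<Longrightarrow> r < s \<Longrightarrow> x \<in> nbhd s A"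
  by (subst mem_nbhd_iff) (use zero_le_dist[of x a] in \<open>auto intro: le_less_trans simp del: zero_le_dist\<close>)

lemma hausdorff_distance_leI:
  "0 \<le> r \<Longrightarrow> A \<subseteq> nbhd r B \<Longrightarrow> B \<subseteq> nbhd r A \<Longrightarrow> hausdorff_distance A B \<le> ennreal r"
  unfolding hausdorff_distance_def by (rule Inf_lower) auto

text \<open>The infimum need not be attained, so one unit of slack buys an admissible
  radius.\<close>

lemma hausdorff_distance_leD:
  assumes "hausdorff_distance A B \<le> ennreal k" "0 \<le> k"
  shows "\<forall>a\<in>A. \<exists>b\<in>B. dist a b \<le> k + 1" "\<forall>b\<in>B. \<exists>a\<in>A. dist b a \<le> k + 1"
proof -
  have "hausdorff_distance A B < ennreal (k + 1)"
    using assms by (intro le_less_trans[OF assms(1)]) (simp add: ennreal_less_iff)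
  then obtain r where "0 \<le> r" "A \<subseteq> nbhd r B" "B \<subseteq> nbhd r A" "r < k + 1"
    unfolding hausdorff_distance_def Inf_less_iff by (auto simp: ennreal_less_iff)
  then show "\<forall>a\<in>A. \<exists>b\<in>B. dist a b \<le> k + 1" "\<forall>b\<in>B. \<exists>a\<in>A. dist b a \<le> k + 1"
    using nbhdD by (meson less_imp_le order_trans subsetD)+
qed

text \<open>A non-strict variant of \<open>nbhd\<close> without the exceptional radius 0, so that
  radii simply add. Returning to \<open>nbhd\<close> costs an arbitrarily small increase.\<close>

definition near :: "real \<Rightarrow> 'a::metric_space \<Rightarrow> 'a set \<Rightarrow> bool" where
  "near r x A \<longleftrightarrow> (\<exists>a\<in>A. dist x a \<le> r)"

lemma near_mono: "near r x A \<Longrightarrow> r \<le> s \<Longrightarrow> near s x A"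
  unfolding near_def by (meson order_trans)

lemma near_dist: "near r x A \<Longrightarrow> dist y x \<le> s \<Longrightarrow> near (s + r) y A"
  unfolding near_def by (meson add_mono dist_triangle order_trans)

lemma near_trans: "near r x A \<Longrightarrow> (\<And>a. a \<in> A \<Longrightarrow> near s a B) \<Longrightarrow> near (r + s) x B"
  by (metis near_def near_dist)

lemma near_imp_nbhd: "near r x A \<Longrightarrow> r < s \<Longrightarrow> x \<in> nbhd s A"
  unfolding near_def using nbhdI by blast

lemma nbhd_imp_near: "x \<in> nbhd s A \<Longrightarrow> 0 \<le> s \<Longrightarrow> near s x A"
  unfolding near_def by (rule nbhdD)

lemma uniform_bound:
  fixes f :: "'b \<Rightarrow> 'c \<Rightarrow> real"
  assumes "finite S" "\<And>s. s \<in> S \<Longrightarrow> \<exists>C. \<forall>v. f s v \<le> C"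
  shows "\<exists>C\<ge>0. \<forall>s\<in>S. \<forall>v. f s v \<le> C"
  using assms
proof (induction S)
  case (insert s S)
  then obtain C D where "0 \<le> C" "\<forall>s\<in>S. \<forall>v. f s v \<le> C" "\<forall>v. f s v \<le> D"
    by (metis insertCI)
  then have "\<forall>s\<in>insert s S. \<forall>v. f s v \<le> max C D" "0 \<le> max C D"
    by (auto simp: le_max_iff_disj)
  then show ?case
    by blast
qed auto

text \<open>The affine interval axioms with a single constant \<open>L\<close> for all slopes and
  intercepts, and with a chosen point \<open>\<mu> a b c\<close> of the triple intersection.\<close>

locale coarse_median_intervals =
  fixes I :: "'a::metric_space \<Rightarrow> 'a \<Rightarrow> 'a set" and \<mu> :: "'a \<Rightarrow> 'a \<Rightarrow> 'a \<Rightarrow> 'a" and L :: real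
  assumes L: "1 \<le> L"
    and degenerate: "near R x (I a a) \<Longrightarrow> dist x a \<le> R + L"
    and flip: "near R x (I a b) \<Longrightarrow> near (R + L) x (I b a)"
    and subinterval: "\<lbrakk>0 \<le> R; near R c (I a b); near S y (I a c)\<rbrakk> \<Longrightarrow> near (S + L * R + L) y (I a b)"
    and median: "near L (\<mu> a b c) (I a b)" "near L (\<mu> a b c) (I b c)" "near L (\<mu> a b c) (I a c)"
    and unique: "\<lbrakk>0 \<le> R; near R x (I a b); near R x (I b c); near R x (I a c);
        near R y (I a b); near R y (I b c); near R y (I a c)\<rbrakk> \<Longrightarrow> dist x y \<le> L * R + L"

lemma affine_intervals_imp_coarse_median_intervals:
  assumes cis: "coarse_interval_structure I k0 k1 \<Phi> \<Psi>"
    and aff: "affine_interval_parameters k0 k1 \<Phi> \<Psi>"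
  shows "\<exists>\<mu> L. coarse_median_intervals I \<mu> L"
proof -
  obtain \<alpha> \<beta> \<gamma> \<theta> where \<Phi>: "\<And>x. 0 \<le> x \<Longrightarrow> \<Phi> x = \<alpha> * x + \<beta>"
    and \<Psi>: "\<And>x. k1 \<le> x \<Longrightarrow> \<Psi> x = \<gamma> * x + \<theta>"
    using aff unfolding affine_interval_parameters_def affine_function_on_def
    by (metis atLeast_iff)
  have k0: "0 \<le> k0" and k1: "0 \<le> k1" and \<Phi>0: "\<And>R. 0 \<le> R \<Longrightarrow> 0 \<le> \<Phi> R"
    and \<Psi>0: "\<And>R. k1 \<le> R \<Longrightarrow> 0 \<le> \<Psi> R"
    using cis unfolding coarse_interval_structure_def by auto
  \<comment> \<open>The summand with \<open>k0 + k1 + 3\<close> pays for evaluating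
    \<open>\<Psi>\<close> at the enlarged radius \<open>R'\<close> in the uniqueness axiom.\<close>
  define L where "L = 1 + k0 + k1 + \<bar>\<alpha>\<bar> + \<bar>\<beta>\<bar> + \<bar>\<gamma>\<bar> * (k0 + k1 + 3) + \<bar>\<theta>\<bar>"
  have \<gamma>k: "0 \<le> \<bar>\<gamma>\<bar> * (k0 + k1 + 3)" "\<bar>\<gamma>\<bar> \<le> \<bar>\<gamma>\<bar> * (k0 + k1 + 3)"
    using k0 k1 by (auto intro: mult_left_le[of 1, simplified] simp: mult_le_cancel_left1)
  have L: "1 + k0 + k1 \<le> L" "\<bar>\<alpha>\<bar> + \<bar>\<beta>\<bar> \<le> L" "\<bar>\<gamma>\<bar> * (k0 + k1 + 3) + \<bar>\<theta>\<bar> \<le> L" "\<bar>\<gamma>\<bar> \<le> L" "\<bar>\<alpha>\<bar> \<le> L"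
    using k0 k1 \<gamma>k unfolding L_def by linarith+
  have flip: "near (R + (k0 + 1)) x (I b a)" if "near R x (I a b)" for R x a b
  proof (rule near_trans[OF that])
    show "near (k0 + 1) y (I b a)" if "y \<in> I a b" for y
      using hausdorff_distance_leD(1)[of "I a b" "I b a" k0] cis that
      unfolding coarse_interval_structure_def near_def by blast
  qed
  define \<mu> where "\<mu> a b c = (SOME x. x \<in> nbhd k1 (I a b) \<inter> nbhd k1 (I c b) \<inter> nbhd k1 (I a c))"
    for a b c
  have \<mu>: "\<mu> a b c \<in> nbhd k1 (I a b) \<inter> nbhd k1 (I c b) \<inter> nbhd k1 (I a c)" for a b c
  proof -
    have "nbhd k1 (I a b) \<inter> nbhd k1 (I c b) \<inter> nbhd k1 (I a c) \<noteq> {}"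
      using cis unfolding coarse_interval_structure_def by blast
    then show ?thesis
      unfolding \<mu>_def some_in_eq .
  qed
  have "coarse_median_intervals I \<mu> L"
  proof
    show "1 \<le> L"
      using L k0 k1 by linarith
    fix R x a assume "near R x (I a a)"
    moreover have "near (k0 + 1) y {a}" if "y \<in> I a a" for y
      using hausdorff_distance_leD(2)[of "{a}" "I a a" k0] cis that
      unfolding coarse_interval_structure_def near_def by blast
    ultimately have "near (R + (k0 + 1)) x {a}"
      by (rule near_trans)
    then show "dist x a \<le> R + L"
      using L k1 unfolding near_def by auto
  next
    show "near (R + L) x (I b a)" if "near R x (I a b)" for R x a b
      using L k1 by (intro near_mono[OF flip[OF that]]) simp
  next
    fix R c a b S y assume R: "0 \<le> R" and c: "near R c (I a b)" and y: "near S y (I a c)"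
    \<comment> \<open>The radius grows by 1 because nearness is non-strict and \<open>nbhd\<close>
      is strict.\<close>
    have "I a c \<subseteq> nbhd (\<Phi> (R + 1)) (I a b)"
      using cis near_imp_nbhd[OF c, of "R + 1"] R unfolding coarse_interval_structure_def by auto
    then have "near (S + \<Phi> (R + 1)) y (I a b)"
      using y near_trans nbhd_imp_near \<Phi>0[of "R + 1"] R by (metis add_nonneg_nonneg subsetD zero_le_one)
    moreover have "\<alpha> * (R + 1) \<le> \<bar>\<alpha>\<bar> * (R + 1)"
      using R by (intro mult_right_mono) auto
    moreover have "\<bar>\<alpha>\<bar> * R \<le> L * R"
      using R L by (intro mult_right_mono) auto
    ultimately show "near (S + L * R + L) y (I a b)"
      using L(2) R by (elim near_mono) (simp add: \<Phi> algebra_simps)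
  next
    fix a b c
    have m: "near k1 (\<mu> a b c) (I a b)" "near k1 (\<mu> a b c) (I c b)" "near k1 (\<mu> a b c) (I a c)"
      using \<mu>[of a b c] k1 nbhd_imp_near by blast+
    have "k1 \<le> L" "k1 + (k0 + 1) \<le> L"
      using L k0 by linarith+
    then show "near L (\<mu> a b c) (I a b)" "near L (\<mu> a b c) (I b c)" "near L (\<mu> a b c) (I a c)"
      using m(1,3) flip[OF m(2)] near_mono by blast+
  next
    fix R x a b c y assume R: "0 \<le> R"
      and x: "near R x (I a b)" "near R x (I b c)" "near R x (I a c)"
      and y: "near R y (I a b)" "near R y (I b c)" "near R y (I a c)"
    \<comment> \<open>The radius must be at least \<open>k1\<close>, the left end of the domain of
      \<open>\<Psi>\<close>, and exceed \<open>R + (k0 + 1)\<close>, the cost of reversing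
      \<open>I b c\<close>.\<close>
    define R' where "R' = R + (k0 + k1 + 3)"
    have "z \<in> nbhd R' (I a b) \<inter> nbhd R' (I c b) \<inter> nbhd R' (I a c)"
      if "near R z (I a b)" "near R z (I b c)" "near R z (I a c)" for z
    proof -
      have "R < R'" "R + (k0 + 1) < R'"
        using k0 k1 by (simp_all add: R'_def)
      then show ?thesis
        using that(1,3) flip[OF that(2)] near_imp_nbhd by blast
    qed
    moreover have "ediameter (nbhd R' (I a b) \<inter> nbhd R' (I c b) \<inter> nbhd R' (I a c)) \<le> ennreal (\<Psi> R')"
      using cis k0 R unfolding coarse_interval_structure_def by (simp add: R'_def)
    moreover have "0 \<le> \<Psi> R'"
      using R k0 by (intro \<Psi>0) (simp add: R'_def)
    ultimately have "dist x y \<le> \<Psi> R'"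
      using x y ediameter_le_iff[of "\<Psi> R'"] by blast
    moreover have "\<gamma> * R' \<le> \<bar>\<gamma>\<bar> * R + \<bar>\<gamma>\<bar> * (k0 + k1 + 3)"
      unfolding R'_def distrib_left[symmetric] using R k0 k1 by (intro mult_right_mono) auto
    moreover have "\<bar>\<gamma>\<bar> * R \<le> L * R"
      using R L by (intro mult_right_mono) auto
    moreover have "\<Psi> R' = \<gamma> * R' + \<theta>"
      using R k0 by (intro \<Psi>) (simp add: R'_def)
    ultimately show "dist x y \<le> L * R + L"
      using L(3) by linarith
  qed
  then show ?thesis
    by blast
qed

section \<open>Lipschitz bound for the chosen median, and approximation by finite median
  algebras\<close>

context coarse_median_intervals
begin

text \<open>The point \<open>\<mu> a b b\<close> is near \<open>I b b\<close>, hence close to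
  \<open>b\<close>, and it is also near \<open>I a b\<close>.\<close>

lemma near_right: "near (4 * L) b (I a b)"
proof -
  have "dist (\<mu> a b b) b \<le> 2 * L"
    using degenerate[OF median(2)[of a b b]] by simp
  then have "near (2 * L + L) b (I a b)"
    using median(1) by (metis dist_commute near_dist)
  then show ?thesis
    using L by (elim near_mono) simp
qed

lemma move_right:
  assumes "near S m (I a b)" "dist b b' \<le> r"
  shows "near (S + L * (r + 4 * L) + L) m (I a b')"
proof (rule subinterval[OF _ _ assms(1)])
  show "near (r + 4 * L) b (I a b')"
    by (rule near_dist[OF near_right assms(2)])
  show "0 \<le> r + 4 * L"
    using L assms(2) zero_le_dist[of b b'] by linarith
qed

lemma move_ends:
  assumes "near S m (I a b)" "dist a a' \<le> r" "dist b b' \<le> r"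
  shows "near (S + 2 * (L * (r + 4 * L)) + 4 * L) m (I a' b')"
  using flip[OF move_right[OF flip[OF move_right[OF assms(1,3)]] assms(2)]] 
  by (elim near_mono) simp

text \<open>Once the endpoints are moved, \<open>\<mu> a1 a2 a3\<close> is near the three intervals
  that determine \<open>\<mu> b1 b2 b3\<close>, with a radius affine in the total displacement.
  Coarse uniqueness then compares the two medians.\<close>

lemma median_coarsely_lipschitz:
  "dist (\<mu> a1 a2 a3) (\<mu> b1 b2 b3)
     \<le> 2 * L\<^sup>2 * (dist a1 b1 + dist a2 b2 + dist a3 b3) + (L * (8 * L\<^sup>2 + 5 * L) + L)"
proof -
  define r where "r = dist a1 b1 + dist a2 b2 + dist a3 b3"
  have r: "dist a1 b1 \<le> r" "dist a2 b2 \<le> r" "dist a3 b3 \<le> r" and r0: "0 \<le> r"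
    by (auto simp: r_def)
  define R where "R = L + 2 * (L * (r + 4 * L)) + 4 * L"
  have "L \<le> R" "0 \<le> R"
    unfolding R_def using L r0 by (auto intro!: add_nonneg_nonneg mult_nonneg_nonneg)
  moreover have "near R m (I b b')" if "near L m (I a a')" "dist a b \<le> r" "dist a' b' \<le> r"
    for m a a' b b'
    using move_ends[OF that] unfolding R_def .
  ultimately have "dist (\<mu> a1 a2 a3) (\<mu> b1 b2 b3) \<le> L * R + L"
    using median[of a1 a2 a3] median[of b1 b2 b3, THEN near_mono] r
    by (intro unique[of R _ b1 b2 b3]) simp_all
  then show ?thesis
    unfolding r_def[symmetric] by (simp add: R_def algebra_simps power2_eq_square)
qed

text \<open>A function \<open>'t \<Rightarrow> 'a\<close> is a family of points; \<open>fbtw\<close> absorbs all constants, which makes the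
  coarse axioms exact.\<close>

definition fbtw :: "('t \<Rightarrow> 'a) \<Rightarrow> ('t \<Rightarrow> 'a) \<Rightarrow> ('t \<Rightarrow> 'a) \<Rightarrow> bool" where
  "fbtw a x b \<longleftrightarrow> (\<exists>R\<ge>0. \<forall>t. near R (x t) (I (a t) (b t)))"

definition fmed :: "('t \<Rightarrow> 'a) \<Rightarrow> ('t \<Rightarrow> 'a) \<Rightarrow> ('t \<Rightarrow> 'a) \<Rightarrow> 't \<Rightarrow> 'a" where
  "fmed a b c t = \<mu> (a t) (b t) (c t)"

lemma fbtw_self_iff: "fbtw x y x \<longleftrightarrow> (\<exists>C\<ge>0. \<forall>t. dist (x t) (y t) \<le> C)"
proof
  assume "fbtw x y x"
  then obtain R where "0 \<le> R" "\<And>t. near R (y t) (I (x t) (x t))"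
    unfolding fbtw_def by blast
  then show "\<exists>C\<ge>0. \<forall>t. dist (x t) (y t) \<le> C"
    using L degenerate by (intro exI[of _ "R + L"]) (simp, metis dist_commute)
next
  assume "\<exists>C\<ge>0. \<forall>t. dist (x t) (y t) \<le> C"
  then obtain C where C: "0 \<le> C" "\<And>t. dist (y t) (x t) \<le> C"
    by (metis dist_commute)
  have "\<forall>t. near (C + 4 * L) (y t) (I (x t) (x t))"
    using near_dist[OF near_right] C by blast
  then show "fbtw x y x"
    unfolding fbtw_def using C L by (intro exI[of _ "C + 4 * L"]) simp
qed

lemma fbtw_sym:
  assumes "fbtw a x b"
  shows "fbtw b x a"
proof -
  obtain R where "0 \<le> R" "\<And>t. near R (x t) (I (a t) (b t))"
    using assms unfolding fbtw_def by blast
  then show ?thesis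
    unfolding fbtw_def using L flip by (intro exI[of _ "R + L"]) simp
qed

sublocale families: betweenness fbtw fmed
proof
  fix a b c x y :: "'t \<Rightarrow> 'a"
  show "fbtw a a b"
    using near_right L by (intro fbtw_sym[of b a a], unfold fbtw_def) (rule exI[of _ "4 * L"], simp)
  show "fbtw b x a" if "fbtw a x b"
    using that by (rule fbtw_sym)
  show "fbtw a y b" if x: "fbtw a x b" and y: "fbtw a y x"
  proof -
    obtain R S where "0 \<le> R" "0 \<le> S" "\<forall>t. near R (x t) (I (a t) (b t))" "\<forall>t. near S (y t) (I (a t) (x t))"
      using x y unfolding fbtw_def by blast
    then have "0 \<le> S + L * R + L" "\<forall>t. near (S + L * R + L) (y t) (I (a t) (b t))"
      using L subinterval by (simp, blast)
    then show ?thesis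
      unfolding fbtw_def by blast
  qed
  show "fbtw a (fmed a b c) b" "fbtw b (fmed a b c) c" "fbtw a (fmed a b c) c"
    unfolding fbtw_def fmed_def by (rule exI[of _ L], use median L in simp)+
  show "fbtw x y x" if "fbtw a x b" "fbtw b x c" "fbtw a x c" "fbtw a y b" "fbtw b y c" "fbtw a y c"
  proof -
    \<comment> \<open>Nearness persists for larger radii, so the six hypotheses share a
      radius.\<close>
    have ev: "\<forall>\<^sub>F R in at_top. \<forall>t. near R (f t) (I (g t) (h t))" if "fbtw g f h" for f g h :: "'t \<Rightarrow> 'a"
      using that near_mono unfolding fbtw_def eventually_at_top_linorder by meson
    have "\<forall>\<^sub>F R in at_top. 0 \<le> R \<and> (\<forall>t. dist (x t) (y t) \<le> L * R + L)"
      using that[THEN ev] eventually_ge_at_top[of 0] by eventually_elim (blast intro: unique)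
    then obtain R where "0 \<le> R" "\<And>t. dist (x t) (y t) \<le> L * R + L"
      using eventually_happens' by (metis (mono_tags, lifting) trivial_limit_at_top_linorder)
    then show ?thesis
      unfolding fbtw_self_iff using L by (intro exI[of _ "L * R + L"]) simp
  qed
qed

text \<open>The constant is found before \<open>A\<close> is given: one finite model, built from
  \<open>p\<close> coordinate projections, serves all valuations, and an enumeration of
  \<open>A\<close> is one of them.\<close>

lemma finite_approximation:
  "\<exists>C\<ge>0. \<forall>A :: 'a set. finite A \<and> card A \<le> p \<longrightarrow>
     (\<exists>(M::nat set) m (i::'a \<Rightarrow> nat) (l::nat \<Rightarrow> 'a).
        finite M \<and> median_algebra_on M m \<and> i ` A \<subseteq> M \<and> (\<forall>a\<in>A. dist a (l (i a)) \<le> C) \<and>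
        (\<forall>x\<in>M. \<forall>y\<in>M. \<forall>z\<in>M. dist (l (m x y z)) (\<mu> (l x) (l y) (l z)) \<le> C))"
proof -
  define G where "G = (\<lambda>j v. (v :: nat \<Rightarrow> 'a) j) ` {..<p}"
  have "finite G"
    by (simp add: G_def)
  then obtain M :: "nat set" and m enc dec where M: "finite M" "median_algebra_on M m"
    and enc: "enc ` families.gen G \<subseteq> M" "\<And>x. x \<in> families.gen G \<Longrightarrow> fbtw x (dec (enc x)) x"
    and dec: "\<And>x y z. x \<in> M \<Longrightarrow> y \<in> M \<Longrightarrow> z \<in> M \<Longrightarrow>
      fbtw (dec (m x y z)) (fmed (dec x) (dec y) (dec z)) (dec (m x y z))"
    using families.finite_median_model[of G] by metis
  have "\<exists>C\<ge>0. \<forall>g\<in>G. \<forall>v. dist (g v) (dec (enc g) v) \<le> C"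
    using \<open>finite G\<close> enc(2)[OF families.gen.base] unfolding fbtw_self_iff
    by (intro uniform_bound) blast+
  then obtain C where C: "0 \<le> C" "\<And>g v. g \<in> G \<Longrightarrow> dist (g v) (dec (enc g) v) \<le> C"
    by blast
  have "\<exists>C\<ge>0. \<forall>t\<in>M \<times> M \<times> M. \<forall>v. (\<lambda>(x, y, z) v.
      dist (dec (m x y z) v) (\<mu> (dec x v) (dec y v) (dec z v))) t v \<le> C"
    using M(1) dec unfolding fbtw_self_iff fmed_def by (intro uniform_bound) (auto, blast)
  then obtain D where D: "0 \<le> D" "\<And>x y z v. x \<in> M \<Longrightarrow> y \<in> M \<Longrightarrow> z \<in> M \<Longrightarrow>
      dist (dec (m x y z) v) (\<mu> (dec x v) (dec y v) (dec z v)) \<le> D"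
    by force
  show ?thesis
  proof (intro exI[of _ "C + D"] conjI allI impI)
    show "0 \<le> C + D"
      using C D by simp
    fix A :: "'a set" assume A: "finite A \<and> card A \<le> p"
    obtain v where v: "bij_betw v {0..<card A} A"
      using ex_bij_betw_nat_finite A by blast
    \<comment> \<open>The projection to the index of \<open>a\<close> in the enumeration
      \<open>v\<close>; its value at \<open>v\<close> is \<open>a\<close>.\<close>
    define pr where "pr a = (\<lambda>w :: nat \<Rightarrow> 'a. w (inv_into {0..<card A} v a))" for a
    have pr: "pr a \<in> G" "pr a v = a" if "a \<in> A" for a
    proof -
      have "inv_into {0..<card A} v a \<in> {0..<card A}"
        using that v by (metis bij_betw_def inv_into_into)
      then show "pr a \<in> G"
        using A unfolding pr_def G_def by auto
      show "pr a v = a"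
        unfolding pr_def using that v by (metis bij_betw_def f_inv_into_f)
    qed
    show "\<exists>(M::nat set) m (i::'a \<Rightarrow> nat) (l::nat \<Rightarrow> 'a).
        finite M \<and> median_algebra_on M m \<and> i ` A \<subseteq> M \<and> (\<forall>a\<in>A. dist a (l (i a)) \<le> C + D) \<and>
        (\<forall>x\<in>M. \<forall>y\<in>M. \<forall>z\<in>M. dist (l (m x y z)) (\<mu> (l x) (l y) (l z)) \<le> C + D)"
    proof (intro exI[of _ M] exI[of _ m] exI[of _ "\<lambda>a. enc (pr a)"] exI[of _ "\<lambda>n. dec n v"] conjI ballI)
      show "(\<lambda>a. enc (pr a)) ` A \<subseteq> M"
        using enc(1) pr(1) families.gen.base by blast
      show "dist a (dec (enc (pr a)) v) \<le> C + D" if "a \<in> A" for a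
        using C(2)[OF pr(1)[OF that], of v] pr(2)[OF that] D(1) by simp
      show "dist (dec (m x y z) v) (\<mu> (dec x v) (dec y v) (dec z v)) \<le> C + D"
        if "x \<in> M" "y \<in> M" "z \<in> M" for x y z
        using D(2)[OF that, of v] C(1) by simp
    qed (use M in auto)
  qed
qed

lemma bowditch: "bowditch_coarse_median \<mu>"
proof -
  obtain C where C: "\<And>p. 0 \<le> C p" and approx: "\<And>p (A :: 'a set). finite A \<Longrightarrow> card A \<le> p \<Longrightarrow>
     \<exists>(M::nat set) m (i::'a \<Rightarrow> nat) (l::nat \<Rightarrow> 'a).
        finite M \<and> median_algebra_on M m \<and> i ` A \<subseteq> M \<and> (\<forall>a\<in>A. dist a (l (i a)) \<le> C p) \<and>
        (\<forall>x\<in>M. \<forall>y\<in>M. \<forall>z\<in>M. dist (l (m x y z)) (\<mu> (l x) (l y) (l z)) \<le> C p)"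
    using finite_approximation by metis
  \<comment> \<open>The value at 0 is the additive constant of the Lipschitz bound. The
    approximation condition only concerns \<open>p\<close> at least 1.\<close>
  define h where "h p = (if p = 0 then L * (8 * L\<^sup>2 + 5 * L) + L else C p)" for p :: nat
  show ?thesis
    unfolding bowditch_coarse_median_def
  proof (intro exI[of _ "2 * L\<^sup>2"] exI[of _ h] conjI allI impI; (elim conjE)?)
    show "0 \<le> h p" for p
      using C L by (auto simp: h_def)
    show "dist (\<mu> a1 a2 a3) (\<mu> b1 b2 b3) \<le> 2 * L\<^sup>2 * (dist a1 b1 + dist a2 b2 + dist a3 b3) + h 0"
      for a1 a2 a3 b1 b2 b3
      using median_coarsely_lipschitz by (simp add: h_def)
    fix A :: "'a set" and p assume "finite A" "1 \<le> card A" "card A \<le> p"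
    moreover from this have "h p = C p"
      by (simp add: h_def)
    ultimately show "\<exists>(M::nat set) m (i::'a \<Rightarrow> nat) (l::nat \<Rightarrow> 'a).
        finite M \<and> median_algebra_on M m \<and> i ` A \<subseteq> M \<and> (\<forall>a\<in>A. dist a (l (i a)) \<le> h p) \<and>
        (\<forall>x\<in>M. \<forall>y\<in>M. \<forall>z\<in>M. dist (l (m x y z)) (\<mu> (l x) (l y) (l z)) \<le> h p)"
      using approx by simp
  qed (use L in auto)
qed

end

section \<open>From coarse medians to coarse 1-medians\<close>

lemma dist_chain:
  fixes x y z :: "'a::metric_space"
  shows "dist x y \<le> r \<Longrightarrow> dist y z \<le> s \<Longrightarrow> dist x z \<le> r + s"
  by (meson add_mono dist_triangle order_trans)

text \<open>With \<open>a\<close> fixed, \<open>four_point\<close> is the associativity, up to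
  \<open>L\<close>, of the meet \<open>\<mu> a x y\<close> in the order rooted at
  \<open>a\<close>.\<close>

locale four_point_coarse_median =
  fixes \<mu> :: "'a::metric_space \<Rightarrow> 'a \<Rightarrow> 'a \<Rightarrow> 'a" and L :: real
  assumes L: "1 \<le> L"
    and lipschitz: "dist (\<mu> a1 a2 a3) (\<mu> b1 b2 b3) \<le> L * (dist a1 b1 + dist a2 b2 + dist a3 b3) + L"
    and swap: "dist (\<mu> a b c) (\<mu> b a c) \<le> L"
    and rotate: "dist (\<mu> a b c) (\<mu> b c a) \<le> L"
    and majority: "dist (\<mu> a a b) a \<le> L"
    and four_point: "dist (\<mu> a (\<mu> a b c) d) (\<mu> a b (\<mu> a c d)) \<le> L"

text \<open>The identities hold exactly in a finite median algebra approximating the at most four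
  points \<open>a\<close>, \<open>b\<close>, \<open>c\<close>, \<open>d\<close>, and are transported
  along \<open>l\<close>.\<close>

lemma bowditch_imp_four_point:
  fixes \<mu> :: "'a::metric_space \<Rightarrow> 'a \<Rightarrow> 'a \<Rightarrow> 'a"
  assumes "bowditch_coarse_median \<mu>"
  shows "\<exists>L. four_point_coarse_median \<mu> L"
proof -
  obtain k h where k: "0 \<le> k" and h: "\<And>p. 0 \<le> h p"
    and M1: "\<And>a1 a2 a3 b1 b2 b3. dist (\<mu> a1 a2 a3) (\<mu> b1 b2 b3)
        \<le> k * (dist a1 b1 + dist a2 b2 + dist a3 b3) + h 0"
    and M2: "\<And>A p. finite A \<Longrightarrow> 1 \<le> card A \<Longrightarrow> card A \<le> p \<Longrightarrow>
      \<exists>(M::nat set) m (i::'a \<Rightarrow> nat) (l::nat \<Rightarrow> 'a). finite M \<and> median_algebra_on M m \<and> i ` A \<subseteq> M \<and>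
        (\<forall>a\<in>A. dist a (l (i a)) \<le> h p) \<and>
        (\<forall>x\<in>M. \<forall>y\<in>M. \<forall>z\<in>M. dist (l (m x y z)) (\<mu> (l x) (l y) (l z)) \<le> h p)"
    using assms unfolding bowditch_coarse_median_def by metis
  \<comment> \<open>\<open>e1\<close> and \<open>e2\<close> bound the error after one and two nested
    applications of \<open>\<mu>\<close>. Comparing two expressions through a common point doubles
    them.\<close>
  define e1 where "e1 = 3 * k * h 4 + h 0 + h 4"
  define e2 where "e2 = 3 * k * e1 + h 0 + h 4"
  define L where "L = 1 + k + h 0 + 2 * e1 + 2 * e2"
  have e: "h 4 \<le> e1" "0 \<le> e1" "0 \<le> e2"
    using k h by (auto simp: e1_def e2_def)
  have ids: "dist (\<mu> a b c) (\<mu> b a c) \<le> 2 * e1 \<and> dist (\<mu> a b c) (\<mu> b c a) \<le> 2 * e1 \<and>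
      dist (\<mu> a a b) a \<le> 2 * e1 \<and> dist (\<mu> a (\<mu> a b c) d) (\<mu> a b (\<mu> a c d)) \<le> 2 * e2" for a b c d
  proof -
    have "card {a, b, c, d} \<le> 4" "1 \<le> card {a, b, c, d}"
      using card_length[of "[a, b, c, d]"] by (simp_all add: Suc_le_eq card_gt_0_iff)
    then obtain M :: "nat set" and m and i :: "'a \<Rightarrow> nat" and l
      where m: "median_algebra_on M m" and M: "i a \<in> M" "i b \<in> M" "i c \<in> M" "i d \<in> M"
        and i: "dist a (l (i a)) \<le> h 4" "dist b (l (i b)) \<le> h 4"
          "dist c (l (i c)) \<le> h 4" "dist d (l (i d)) \<le> h 4"
        and l: "\<And>x y z. x \<in> M \<Longrightarrow> y \<in> M \<Longrightarrow> z \<in> M \<Longrightarrow>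
          dist (l (m x y z)) (\<mu> (l x) (l y) (l z)) \<le> h 4"
      using M2[of "{a, b, c, d}" 4] by auto
    have mM: "m x y z \<in> M" if "x \<in> M" "y \<in> M" "z \<in> M" for x y z
      using m that unfolding median_algebra_on_def by blast
    have step: "dist (\<mu> x y z) (l (m x' y' z')) \<le> 3 * k * e + h 0 + h 4"
      if "x' \<in> M" "y' \<in> M" "z' \<in> M" "dist x (l x') \<le> e" "dist y (l y') \<le> e" "dist z (l z') \<le> e"
      for x y z x' y' z' e
    proof -
      have "k * (dist x (l x') + dist y (l y') + dist z (l z')) \<le> k * (3 * e)"
        using that k by (intro mult_left_mono) auto
      then show ?thesis
        using M1[of x y z "l x'" "l y'" "l z'"] l[OF that(1-3)] dist_commute[of "l (m x' y' z')"]
          dist_triangle[of "\<mu> x y z" "l (m x' y' z')" "\<mu> (l x') (l y') (l z')"]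
        by simp
    qed
    note s1 = step[where e = "h 4", folded e1_def] and s2 = step[where e = e1, folded e2_def]
    have syms: "m (i a) (i b) (i c) = m (i b) (i a) (i c)" "m (i a) (i b) (i c) = m (i b) (i c) (i a)"
      "m (i a) (i a) (i b) = i a"
      using m M unfolding median_algebra_on_def by blast+
    have assoc: "m (i a) (m (i a) (i b) (i c)) (i d) = m (i a) (i b) (m (i a) (i c) (i d))"
    proof -
      \<comment> \<open>The five-variable law with a repeated entry, whose first inner median
        collapses to \<open>i a\<close>.\<close>
      have "m (i a) (i b) (m (i a) (i c) (i d)) = m (m (i a) (i b) (i a)) (m (i a) (i b) (i c)) (i d)"
        using m M unfolding median_algebra_on_def by blast
      moreover have "m (i a) (i b) (i a) = i a"
        using m M unfolding median_algebra_on_def by metis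
      ultimately show ?thesis
        by simp
    qed
    have ie: "dist a (l (i a)) \<le> e1" "dist b (l (i b)) \<le> e1" "dist d (l (i d)) \<le> e1"
      using i e by auto
    have abc: "dist (\<mu> a b c) (l (m (i a) (i b) (i c))) \<le> e1"
      and bac: "dist (\<mu> b a c) (l (m (i a) (i b) (i c))) \<le> e1"
      and bca: "dist (\<mu> b c a) (l (m (i a) (i b) (i c))) \<le> e1"
      and aab: "dist (\<mu> a a b) (l (i a)) \<le> e1"
      and acd: "dist (\<mu> a c d) (l (m (i a) (i c) (i d))) \<le> e1"
      using s1[OF M(1,2,3) i(1,2,3)] s1[OF M(2,1,3) i(2,1,3)] s1[OF M(2,3,1) i(2,3,1)]
        s1[OF M(1,1,2) i(1,1,2)] s1[OF M(1,3,4) i(1,3,4)] syms by metis+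
    have "dist (\<mu> a (\<mu> a b c) d) (l (m (i a) (i b) (m (i a) (i c) (i d)))) \<le> e2"
      using s2[OF M(1) mM[OF M(1-3)] M(4) ie(1) abc ie(3)] assoc by simp
    moreover have "dist (\<mu> a b (\<mu> a c d)) (l (m (i a) (i b) (m (i a) (i c) (i d)))) \<le> e2"
      by (rule s2[OF M(1,2) mM[OF M(1,3,4)] ie(1,2) acd])
    ultimately show ?thesis
      using abc bac bca aab ie(1) dist_triangle2[of "\<mu> a b c" "\<mu> b a c" "l (m (i a) (i b) (i c))"]
        dist_triangle2[of "\<mu> a b c" "\<mu> b c a" "l (m (i a) (i b) (i c))"]
        dist_triangle2[of "\<mu> a a b" a "l (i a)"]
        dist_triangle2[of "\<mu> a (\<mu> a b c) d" "\<mu> a b (\<mu> a c d)" "l (m (i a) (i b) (m (i a) (i c) (i d)))"]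
      by linarith
  qed
  have "four_point_coarse_median \<mu> L"
  proof
    show "1 \<le> L"
      using k h e by (simp add: L_def)
    have le: "2 * e1 \<le> L" "2 * e2 \<le> L" "k \<le> L" "h 0 \<le> L"
      using k h[of 0] e by (auto simp: L_def)
    fix a b c d
    show "dist (\<mu> a b c) (\<mu> b a c) \<le> L" "dist (\<mu> a b c) (\<mu> b c a) \<le> L" "dist (\<mu> a a b) a \<le> L"
      "dist (\<mu> a (\<mu> a b c) d) (\<mu> a b (\<mu> a c d)) \<le> L"
      using ids[of a b c d] le by linarith+
    fix a1 a2 a3 b1 b2 b3 :: 'a
    have "k * (dist a1 b1 + dist a2 b2 + dist a3 b3) \<le> L * (dist a1 b1 + dist a2 b2 + dist a3 b3)"
      using le by (intro mult_right_mono) auto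
    then show "dist (\<mu> a1 a2 a3) (\<mu> b1 b2 b3) \<le> L * (dist a1 b1 + dist a2 b2 + dist a3 b3) + L"
      using M1[of a1 a2 a3 b1 b2 b3] le by linarith
  qed
  then show ?thesis
    by blast
qed

section \<open>Displacement estimates and the resulting structure\<close>

context four_point_coarse_median
begin

lemma lipschitz2:
  assumes "dist x y \<le> r"
  shows "dist (\<mu> a x b) (\<mu> a y b) \<le> L * r + L"
proof -
  have "L * dist x y \<le> L * r"
    using assms L by (intro mult_left_mono) auto
  then show ?thesis
    using lipschitz[of a x b a y b] by simp
qed

lemma lipschitz3:
  assumes "dist x y \<le> r"
  shows "dist (\<mu> a b x) (\<mu> a b y) \<le> L * r + L"
proof -
  have "L * dist x y \<le> L * r"
    using assms L by (intro mult_left_mono) auto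
  then show ?thesis
    using lipschitz[of a b x a b y] by simp
qed

lemma majority': "dist (\<mu> a b b) b \<le> L + L"
  by (rule dist_chain[OF rotate majority])

lemma majority'': "dist (\<mu> a b a) a \<le> L + L"
proof -
  have "dist (\<mu> a b a) (\<mu> a a b) \<le> L"
    using rotate[of a a b] by (simp add: dist_commute)
  from dist_chain[OF this majority] show ?thesis .
qed

text \<open>The four-point identity with a repeated \<open>b\<close>, where
  \<open>\<mu> a b b\<close> is close to \<open>b\<close>.\<close>

lemma projection: "dist (\<mu> a b s) (\<mu> a b (\<mu> a b s)) \<le> 2 * L\<^sup>2 + 2 * L"
proof -
  have "dist b (\<mu> a b b) \<le> L + L"
    using majority' by (simp add: dist_commute)
  from dist_chain[OF lipschitz2[OF this] four_point] show ?thesis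
    by (simp add: algebra_simps power2_eq_square)
qed

text \<open>Whether \<open>x\<close> lies coarsely between \<open>a\<close> and \<open>b\<close> is measured by the displacement
  \<^term>\<open>dist x (\<mu> a b x)\<close>.\<close>

lemma displacement_if_near:
  assumes "near r x (range (\<mu> a b))"
  shows "dist x (\<mu> a b x) \<le> (1 + L) * r + (2 * L\<^sup>2 + 3 * L)"
proof -
  obtain s where s: "dist x (\<mu> a b s) \<le> r"
    using assms unfolding near_def by blast
  then have "dist (\<mu> a b s) x \<le> r"
    by (simp add: dist_commute)
  from dist_chain[OF dist_chain[OF s projection] lipschitz3[OF this]] show ?thesis
    by (simp add: algebra_simps)
qed

lemma near_if_displacement: "dist x (\<mu> a b x) \<le> r \<Longrightarrow> near r x (range (\<mu> a b))"
  unfolding near_def by blast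

lemma displacement_flip: "dist x (\<mu> a b x) \<le> r \<Longrightarrow> dist x (\<mu> b a x) \<le> r + L"
  using dist_chain swap by blast

text \<open>The chain runs from \<open>y\<close> through \<open>\<mu> a c y\<close>,
  \<open>\<mu> a (\<mu> a b c) y\<close> and \<open>\<mu> a b (\<mu> a c y)\<close> to
  \<open>\<mu> a b y\<close>.\<close>

lemma displacement_subinterval:
  assumes c: "dist c (\<mu> a b c) \<le> r" and y: "dist y (\<mu> a c y) \<le> s"
  shows "dist y (\<mu> a b y) \<le> s + L * r + 3 * L + L * s"
proof -
  have "dist (\<mu> a c y) y \<le> s"
    using y by (simp add: dist_commute)
  from dist_chain[OF dist_chain[OF dist_chain[OF y lipschitz2[OF c]] four_point] lipschitz3[OF this]]
  show ?thesis
    by simp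
qed

text \<open>The coarse counterpart of \<open>meet_greatest\<close>: \<open>x\<close> is close to
  \<open>\<mu> a b (\<mu> a c x)\<close>, and associativity finishes.\<close>

lemma displacement_median:
  assumes ab: "dist x (\<mu> a b x) \<le> r" and ac: "dist x (\<mu> a c x) \<le> r"
  shows "dist x (\<mu> a (\<mu> a b c) x) \<le> (1 + L) * r + 2 * L"
proof -
  have "dist (\<mu> a b (\<mu> a c x)) (\<mu> a (\<mu> a b c) x) \<le> L"
    using four_point[of a b c x] by (simp add: dist_commute)
  from dist_chain[OF dist_chain[OF ab lipschitz3[OF ac]] this] show ?thesis
    by (simp add: algebra_simps)
qed

text \<open>With \<open>p\<close> for \<open>\<mu> a b c\<close>, the point \<open>x\<close> is
  coarsely between \<open>p\<close> and each of \<open>a\<close> and \<open>b\<close>. It is thus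
  close to \<open>\<mu> p a (\<mu> p b x)\<close>, hence to \<open>\<mu> p (\<mu> p a b) x\<close>.
  Since \<open>\<mu> p a b\<close> is close to \<open>p\<close>, majority yields
  \<open>p\<close>.\<close>

lemma coarsely_unique:
  assumes ab: "dist x (\<mu> a b x) \<le> r" and bc: "dist x (\<mu> b c x) \<le> r" and ac: "dist x (\<mu> a c x) \<le> r"
  shows "dist x (\<mu> a b c) \<le> (1 + 2 * L + L\<^sup>2) * r + (4 * L ^ 3 + 8 * L\<^sup>2 + 7 * L)"
proof -
  define p where "p = \<mu> a b c"
  have ma: "dist x (\<mu> p a x) \<le> ((1 + L) * r + 2 * L) + L"
    using dist_chain[OF displacement_median[OF ab ac] swap] unfolding p_def .
  have ba: "dist x (\<mu> b a x) \<le> r + L" and bc': "dist x (\<mu> b c x) \<le> r + L"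
    using displacement_flip[OF ab] bc L by auto
  have "dist (\<mu> b a c) p \<le> L"
    unfolding p_def by (rule swap)
  from dist_chain[OF dist_chain[OF displacement_median[OF ba bc'] lipschitz2[OF this]] swap]
  have mb: "dist x (\<mu> p b x) \<le> ((1 + L) * (r + L) + 2 * L) + (L * L + L) + L" .
  have "dist (\<mu> a b p) p \<le> 2 * L\<^sup>2 + 2 * L"
    using projection[of a b c] by (simp add: p_def dist_commute)
  from dist_chain[OF rotate this] have "dist (\<mu> p a b) p \<le> L + (2 * L\<^sup>2 + 2 * L)" .
  from dist_chain[OF lipschitz2[OF this] majority]
  have close: "dist (\<mu> p (\<mu> p a b) x) p \<le> L * (L + (2 * L\<^sup>2 + 2 * L)) + L + L" .
  have "dist (\<mu> p a (\<mu> p b x)) (\<mu> p (\<mu> p a b) x) \<le> L"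
    using four_point[of p a b x] by (simp add: dist_commute)
  from dist_chain[OF dist_chain[OF dist_chain[OF ma lipschitz3[OF mb]] this] close]
  show ?thesis
    by (simp add: p_def algebra_simps power2_eq_square power3_eq_cube)
qed

lemma coarse_1_median:
  "\<exists>\<Lambda> \<delta>0 lam \<Psi>. coarse_1_median_structure (\<lambda>a. {a}) (\<lambda>a b. range (\<mu> a b)) \<Lambda> \<delta>0 lam \<Psi> \<and>
     affine_1_median_parameters \<Lambda> \<delta>0 \<Psi>"
proof -
  \<comment> \<open>As \<open>1 \<le> L\<close>, the cube dominates lower powers; the factor 30
    leaves room for the errors in the filling axioms.\<close>
  define P where "P = 30 * L ^ 3"
  define \<Lambda> where "\<Lambda> R = P * R + P" for R
  \<comment> \<open>\<open>B\<close> and \<open>E\<close> come from inserting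
    \<open>displacement_if_near\<close> into \<open>coarsely_unique\<close>, doubled because two
    points are compared through the median.\<close>
  define B where "B = 2 * ((1 + 2 * L + L\<^sup>2) * (1 + L))"
  define E where "E = 2 * ((1 + 2 * L + L\<^sup>2) * (2 * L\<^sup>2 + 3 * L) + (4 * L ^ 3 + 8 * L\<^sup>2 + 7 * L))"
  define \<Psi> where "\<Psi> \<delta> D = B * \<delta> + E" for \<delta> D :: real
  have pow: "L \<le> L ^ 3" "L\<^sup>2 \<le> L ^ 3" "1 \<le> L ^ 3"
    using L power_increasing[of 1 3 L] power_increasing[of 2 3 L] by auto
  have P: "2 * L < P" "1 < P" "L + L\<^sup>2 \<le> P" "4 * L ^ 3 + 9 * L\<^sup>2 + 7 * L < P"
    using pow L unfolding P_def by linarith+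
  have B: "0 \<le> B" "0 \<le> E"
    using L by (auto simp: B_def E_def)
  have near\<Lambda>: "x \<in> nbhd (\<Lambda> 0) A" if "near r x A" "r \<le> 2 * L" for x r A
    using that P by (intro near_imp_nbhd[OF that(1)]) (simp add: \<Lambda>_def)
  have sub: "range (\<mu> a x) \<subseteq> nbhd (\<Lambda> R) (range (\<mu> a b)) \<and> range (\<mu> x b) \<subseteq> nbhd (\<Lambda> R) (range (\<mu> a b))"
    if R: "0 \<le> R" and x: "x \<in> nbhd R (range (\<mu> a b))" for R a b x
  proof -
    define r where "r = (1 + L) * R + (2 * L\<^sup>2 + 3 * L)"
    have xr: "dist x (\<mu> a b x) \<le> r"
      unfolding r_def by (rule displacement_if_near[OF nbhd_imp_near[OF x R]])
    \<comment> \<open>The last bracket pays for the three reversals needed when the left endpoint is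
      replaced.\<close>
    have bound: "L * r + 3 * L + (2 * L\<^sup>2 + 2 * L) + L * (2 * L\<^sup>2 + 2 * L) + (L + L * L + L * L + L) < \<Lambda> R"
    proof -
      have "(L + L\<^sup>2) * R \<le> P * R"
        using P R by (intro mult_right_mono)
      then show ?thesis
        using P L unfolding r_def \<Lambda>_def by (simp add: algebra_simps power2_eq_square power3_eq_cube)
    qed
    have "y \<in> nbhd (\<Lambda> R) (range (\<mu> a b))" if "y \<in> range (\<mu> a x)" for y
    proof -
      have "dist y (\<mu> a x y) \<le> 2 * L\<^sup>2 + 2 * L"
        using that projection by auto
      from near_if_displacement[OF displacement_subinterval[OF xr this]] show ?thesis
        by (rule near_imp_nbhd) (use bound L zero_le_square[of L] in linarith)
    qed
    moreover have "y \<in> nbhd (\<Lambda> R) (range (\<mu> a b))" if "y \<in> range (\<mu> x b)" for y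
    proof -
      have "dist y (\<mu> x b y) \<le> 2 * L\<^sup>2 + 2 * L"
        using that projection by auto
      then have "dist y (\<mu> b x y) \<le> 2 * L\<^sup>2 + 2 * L + L"
        by (rule displacement_flip)
      from near_if_displacement[OF displacement_flip[OF
          displacement_subinterval[OF displacement_flip[OF xr] this]]]
      show ?thesis
        by (rule near_imp_nbhd) (use bound in \<open>simp add: algebra_simps\<close>)
    qed
    ultimately show ?thesis
      by blast
  qed
  have fill: "coarse_1_filling (\<lambda>a. {a}) (\<lambda>a b. range (\<mu> a b)) \<Lambda>"
    unfolding coarse_1_filling_def
  proof (intro conjI allI impI)
    show "0 \<le> \<Lambda> R" if "0 \<le> R" for R
      using P that by (simp add: \<Lambda>_def)
    show "mono_on {0..} \<Lambda>"
      using P by (auto simp: mono_on_def \<Lambda>_def intro: mult_left_mono)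
    have self: "near 0 x A" if "x \<in> A" for x :: 'a and A
      using that unfolding near_def by force
    have \<Lambda>0: "0 \<le> \<Lambda> 0"
      using P by (simp add: \<Lambda>_def)
    show "hausdorff_distance {a} {a} \<le> ennreal (\<Lambda> 0)" for a :: 'a
      using near\<Lambda>[OF self[of a "{a}"]] L by (intro hausdorff_distance_leI[OF \<Lambda>0]) simp_all
    show "{a} \<subseteq> nbhd (\<Lambda> 0) (range (\<mu> a b))" "{b} \<subseteq> nbhd (\<Lambda> 0) (range (\<mu> a b))" for a b
      using near\<Lambda>[OF near_if_displacement[of a a b]] near\<Lambda>[OF near_if_displacement[of b a b]]
        majority'[of a b] majority''[of a b]
      by (simp_all add: dist_commute)
    have flip: "range (\<mu> a b) \<subseteq> nbhd (\<Lambda> 0) (range (\<mu> b a))" for a b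
    proof safe
      fix s
      have "near L (\<mu> a b s) (range (\<mu> b a))"
        using swap unfolding near_def by blast
      then show "\<mu> a b s \<in> nbhd (\<Lambda> 0) (range (\<mu> b a))"
        by (rule near\<Lambda>) (use L in simp)
    qed
    then show "hausdorff_distance (range (\<mu> a b)) (range (\<mu> b a)) \<le> ennreal (\<Lambda> 0)" for a b
      by (intro hausdorff_distance_leI[OF \<Lambda>0])
    show "range (\<mu> a a) \<subseteq> nbhd (\<Lambda> 0) {a}" for a
    proof safe
      fix s
      have "near L (\<mu> a a s) {a}"
        using majority by (simp add: near_def)
      then show "\<mu> a a s \<in> nbhd (\<Lambda> 0) {a}"
        by (rule near\<Lambda>) (use L in simp)
    qed
    show "{x} \<subseteq> nbhd (\<Lambda> R) {a}" if "0 \<le> R" "x \<in> nbhd R {a}" for R and a x :: 'a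
    proof -
      have "1 * R \<le> P * R"
        using P that by (intro mult_right_mono) auto
      then have "R < \<Lambda> R"
        unfolding \<Lambda>_def using P by linarith
      then show ?thesis
        using near_imp_nbhd nbhd_imp_near that by blast
    qed
  qed (use sub in auto)
  \<comment> \<open>Permuting the arguments of the median costs at most \<open>2 * L\<close>, which
    is strictly below \<open>3 * L\<close>.\<close>
  have CM1: "nbhd (3 * L) (range (\<mu> a1 a2)) \<inter> nbhd (3 * L) (range (\<mu> a0 a2)) \<inter>
      nbhd (3 * L) (range (\<mu> a0 a1)) \<noteq> {}" for a0 a1 a2
  proof -
    let ?x = "\<mu> a1 a2 a0"
    have "near 0 ?x (range (\<mu> a1 a2))" "near (L + L) ?x (range (\<mu> a0 a2))" "near L ?x (range (\<mu> a0 a1))"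
      using dist_chain[OF rotate swap, of a1 a2 a0] rotate[of a0 a1 a2]
      by (force simp: near_def dist_commute)+
    then have "?x \<in> nbhd (3 * L) (range (\<mu> a1 a2)) \<inter> nbhd (3 * L) (range (\<mu> a0 a2)) \<inter>
        nbhd (3 * L) (range (\<mu> a0 a1))"
      using L by (auto elim: near_imp_nbhd)
    then show ?thesis
      by blast
  qed
  have CM2: "ediameter (nbhd \<delta> (range (\<mu> a1 a2)) \<inter> nbhd \<delta> (range (\<mu> a0 a2)) \<inter>
      nbhd \<delta> (range (\<mu> a0 a1))) \<le> ennreal (\<Psi> \<delta> D)" if "3 * L \<le> \<delta>" for \<delta> D a0 a1 a2
  proof -
    have \<delta>: "0 \<le> \<delta>"
      using that L by simp
    define r where "r = (1 + L) * \<delta> + (2 * L\<^sup>2 + 3 * L)"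
    have half: "dist x (\<mu> a0 a1 a2) \<le> \<Psi> \<delta> D / 2"
      if "x \<in> nbhd \<delta> (range (\<mu> a1 a2))" "x \<in> nbhd \<delta> (range (\<mu> a0 a2))" "x \<in> nbhd \<delta> (range (\<mu> a0 a1))"
      for x
    proof -
      have "dist x (\<mu> a1 a2 x) \<le> r" "dist x (\<mu> a0 a2 x) \<le> r" "dist x (\<mu> a0 a1 x) \<le> r"
        unfolding r_def using that[THEN nbhd_imp_near[OF _ \<delta>], THEN displacement_if_near] by auto
      from coarsely_unique[OF this(3,1,2)] show ?thesis
        by (simp add: r_def \<Psi>_def B_def E_def algebra_simps)
    qed
    have "dist x y \<le> \<Psi> \<delta> D"
      if "x \<in> nbhd \<delta> (range (\<mu> a1 a2)) \<inter> nbhd \<delta> (range (\<mu> a0 a2)) \<inter> nbhd \<delta> (range (\<mu> a0 a1))"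
        "y \<in> nbhd \<delta> (range (\<mu> a1 a2)) \<inter> nbhd \<delta> (range (\<mu> a0 a2)) \<inter> nbhd \<delta> (range (\<mu> a0 a1))" for x y
      using that half[of x] half[of y] dist_triangle2[of x y "\<mu> a0 a1 a2"] by simp
    then show ?thesis
      using B \<delta> by (subst ediameter_le_iff) (auto simp: \<Psi>_def)
  qed
  have "coarse_1_median_structure (\<lambda>a. {a}) (\<lambda>a b. range (\<mu> a b)) \<Lambda> (3 * L) (\<lambda>\<delta>. \<delta>) \<Psi>"
    unfolding coarse_1_median_structure_def
  proof (intro conjI allI impI)
    show "0 \<le> 3 * L"
      using L by simp
    show "\<exists>a b. 0 < a \<and> 0 \<le> b \<and> (\<forall>\<delta>\<ge>3 * L. \<delta> = a * (\<delta> - 3 * L) + b)"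
      using L by (intro exI[of _ 1] exI[of _ "3 * L"]) auto
    show "0 \<le> \<Psi> \<delta> D" if "3 * L \<le> \<delta>" for \<delta> D
      using B L that by (simp add: \<Psi>_def)
    show "mono_on {3 * L..} (\<lambda>\<delta>. \<Psi> \<delta> D)" "mono_on {3 * L..} (\<Psi> \<delta>)" for \<delta> D
      using B by (auto simp: \<Psi>_def mono_on_def intro: mult_left_mono)
  qed (use fill CM1 CM2 in blast)+
  moreover have "affine_1_median_parameters \<Lambda> (3 * L) \<Psi>"
    unfolding affine_1_median_parameters_def affine_function_on_def
    by (intro conjI exI[of _ P] exI[of _ B] exI[of _ 0] exI[of _ E]) (auto simp: \<Lambda>_def \<Psi>_def)
  ultimately show ?thesis
    by blast
qed

end

section \<open>From coarse 1-medians to coarse intervals\<close>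

text \<open>A family of faces violating genericity contains a singleton \<open>{i}\<close>, which confines the
  intersection to a ball around \<open>a\<^sub>i\<close>.\<close>

lemma generic_tripleI:
  assumes fill: "coarse_1_filling F0 F1 \<Lambda>" and \<delta>: "0 \<le> \<delta>" and D: "2 * (\<delta> + \<Lambda> 0 + 1) \<le> D"
  shows "generic_triple F0 F1 \<delta> D a0 a1 a2"
  unfolding generic_triple_def
proof (intro allI impI ballI; elim conjE)
  fix q j :: nat and J :: "nat \<Rightarrow> nat set"
  let ?S = "\<Inter>j\<in>{1..q}. nbhd \<delta> (face_filling F0 F1 [a0, a1, a2] (J j))"
  assume J: "\<forall>j\<in>{1..q}. J j \<noteq> {} \<and> J j \<subset> {0, 1, 2}" and large: "ediameter ?S > ennreal D"
    and j: "j \<in> {1..q}"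
  have \<Lambda>0: "0 \<le> \<Lambda> 0"
    using fill unfolding coarse_1_filling_def by auto
  show "card (J j) = 2"
  proof (rule ccontr)
    assume "card (J j) \<noteq> 2"
    moreover have sub: "J j \<noteq> {}" "J j \<subset> {0, 1, 2}"
      using J j by blast+
    then have "finite (J j)"
      using finite_subset[of "J j" "{0, 1, 2}"] by blast
    then have "card (J j) \<noteq> 0"
      using sub by simp
    moreover have "card (J j) < 3"
      using psubset_card_mono[OF _ sub(2)] by simp
    ultimately have "card (J j) = 1"
      by linarith
    then obtain i where i: "J j = {i}"
      by (rule card_1_singletonE)
    define a where "a = [a0, a1, a2] ! i"
    have "face_filling F0 F1 [a0, a1, a2] (J j) = F0 a"
      by (simp add: i face_filling_def a_def)
    then have "?S \<subseteq> nbhd \<delta> (F0 a)"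
      using j by blast
    moreover have "dist x a \<le> \<delta> + (\<Lambda> 0 + 1)" if "x \<in> nbhd \<delta> (F0 a)" for x
    proof -
      have "hausdorff_distance {a} (F0 a) \<le> ennreal (\<Lambda> 0)"
        using fill unfolding coarse_1_filling_def by blast
      from hausdorff_distance_leD(2)[OF this \<Lambda>0]
      have "near (\<Lambda> 0 + 1) y {a}" if "y \<in> F0 a" for y
        using that by (simp add: near_def)
      from near_trans[OF nbhd_imp_near[OF that \<delta>] this] show ?thesis
        by (simp add: near_def)
    qed
    ultimately have ball: "dist x a \<le> \<delta> + (\<Lambda> 0 + 1)" if "x \<in> ?S" for x
      using that by blast
    have "dist x y \<le> D" if "x \<in> ?S" "y \<in> ?S" for x y
      using ball[OF that(1)] ball[OF that(2)] dist_triangle2[of x y a] D by simp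
    moreover have "0 \<le> D"
      using D \<delta> \<Lambda>0 by simp
    ultimately have "ediameter ?S \<le> ennreal D"
      using ediameter_le_iff by blast
    then show False
      using large by simp
  qed
qed

lemma coarse_1_median_imp_intervals:
  assumes cms: "coarse_1_median_structure F0 F1 \<Lambda> \<delta>0 lam \<Psi>"
    and aff: "affine_1_median_parameters \<Lambda> \<delta>0 \<Psi>"
  shows "\<exists>k0 k1 \<Phi> \<Psi>. coarse_interval_structure F1 k0 k1 \<Phi> \<Psi> \<and> affine_interval_parameters k0 k1 \<Phi> \<Psi>"
proof -
  have fill: "coarse_1_filling F0 F1 \<Lambda>" and \<delta>0: "0 \<le> \<delta>0"
    and \<Psi>0: "\<And>\<delta> D. \<delta>0 \<le> \<delta> \<Longrightarrow> \<delta>0 \<le> D \<Longrightarrow> 0 \<le> \<Psi> \<delta> D"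
    and mono1: "\<And>D. \<delta>0 \<le> D \<Longrightarrow> mono_on {\<delta>0..} (\<lambda>\<delta>. \<Psi> \<delta> D)"
    and mono2: "\<And>\<delta>. \<delta>0 \<le> \<delta> \<Longrightarrow> mono_on {\<delta>0..} (\<lambda>D. \<Psi> \<delta> D)"
    and CM1: "\<And>a0 a1 a2. nbhd (lam \<delta>0) (F1 a1 a2) \<inter> nbhd (lam \<delta>0) (F1 a0 a2) \<inter>
        nbhd (lam \<delta>0) (F1 a0 a1) \<noteq> {}"
    and CM2: "\<And>\<delta> D a0 a1 a2. \<delta>0 \<le> \<delta> \<Longrightarrow> \<delta>0 \<le> D \<Longrightarrow> generic_triple F0 F1 \<delta> D a0 a1 a2 \<Longrightarrow>
        ediameter (nbhd (lam \<delta>) (F1 a1 a2) \<inter> nbhd (lam \<delta>) (F1 a0 a2) \<inter> nbhd (lam \<delta>) (F1 a0 a1))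
          \<le> ennreal (\<Psi> \<delta> D)"
    using cms unfolding coarse_1_median_structure_def by auto
  obtain s t where s: "0 < s" and t: "0 \<le> t" and lam: "\<And>\<delta>. \<delta>0 \<le> \<delta> \<Longrightarrow> lam \<delta> = s * (\<delta> - \<delta>0) + t"
    using cms unfolding coarse_1_median_structure_def by auto
  obtain B C E where BCE: "\<And>\<delta> D. \<delta>0 \<le> \<delta> \<Longrightarrow> \<delta>0 \<le> D \<Longrightarrow> \<Psi> \<delta> D = B * \<delta> + C * D + E"
    using aff unfolding affine_1_median_parameters_def by metis
  have \<Lambda>0: "0 \<le> \<Lambda> 0"
    using fill unfolding coarse_1_filling_def by auto
  \<comment> \<open>Comparing \<open>a\<close> with \<open>F1 a a\<close> through
    \<open>F0 a\<close> costs \<open>2 * \<Lambda> 0 + 1\<close>; the remaining unit makes the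
    inequality strict.\<close>
  define k0 where "k0 = 2 * \<Lambda> 0 + 2"
  \<comment> \<open>The inverse of \<open>lam\<close>, used for radii from \<open>t\<close>, the
    value of \<open>lam\<close> at \<open>\<delta>0\<close>, onwards.\<close>
  define dl where "dl R = \<delta>0 + (R - t) / s" for R
  \<comment> \<open>The threshold that makes every triple generic. It is affine in \<open>R\<close>,
    so \<open>\<Psi> (dl R) (D R)\<close> is affine too.\<close>
  define D where "D R = 2 * (dl R + \<Lambda> 0 + 1)" for R
  have dl: "\<delta>0 \<le> dl R" "lam (dl R) = R" "\<delta>0 \<le> D R" if "t \<le> R" for R
  proof -
    show 1: "\<delta>0 \<le> dl R"
      using that s by (simp add: dl_def)
    then show "lam (dl R) = R"
      using s by (simp add: lam) (simp add: dl_def)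
    show "\<delta>0 \<le> D R"
      using 1 \<delta>0 \<Lambda>0 by (simp add: D_def)
  qed
  have dl_mono: "dl R \<le> dl R'" "D R \<le> D R'" if "R \<le> R'" for R R'
    using that s by (auto simp: D_def dl_def divide_right_mono)
  have lam0: "lam \<delta>0 = t"
    by (simp add: lam)
  have "coarse_interval_structure F1 k0 t \<Lambda> (\<lambda>R. \<Psi> (dl R) (D R))"
    unfolding coarse_interval_structure_def
  proof (intro conjI allI impI)
    show k0: "0 \<le> k0"
      using \<Lambda>0 by (simp add: k0_def)
    show "hausdorff_distance (F1 a b) (F1 b a) \<le> ennreal k0" for a b
    proof -
      have "hausdorff_distance (F1 a b) (F1 b a) \<le> ennreal (\<Lambda> 0)"
        using fill unfolding coarse_1_filling_def by blast
      also have "\<dots> \<le> ennreal k0"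
        using \<Lambda>0 by (intro ennreal_leI) (simp add: k0_def)
      finally show ?thesis .
    qed
    show "hausdorff_distance {a} (F1 a a) \<le> ennreal k0" for a
    proof -
      have "hausdorff_distance {a} (F0 a) \<le> ennreal (\<Lambda> 0)"
        using fill unfolding coarse_1_filling_def by blast
      note H = hausdorff_distance_leD[OF this \<Lambda>0]
      have "near (\<Lambda> 0 + 1) a (F0 a)" "\<And>y. y \<in> F0 a \<Longrightarrow> near (\<Lambda> 0 + 1) y {a}"
        using H by (auto simp: near_def)
      moreover have "F0 a \<subseteq> nbhd (\<Lambda> 0) (F1 a a)" "F1 a a \<subseteq> nbhd (\<Lambda> 0) (F0 a)"
        using fill unfolding coarse_1_filling_def by blast+
      then have "near (\<Lambda> 0) y (F1 a a)" if "y \<in> F0 a" for y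
        using that nbhd_imp_near[OF _ \<Lambda>0] by blast
      moreover have "near (\<Lambda> 0) y (F0 a)" if "y \<in> F1 a a" for y
        using that \<open>F1 a a \<subseteq> _\<close> nbhd_imp_near[OF _ \<Lambda>0] by blast
      ultimately have near: "near (\<Lambda> 0 + 1 + \<Lambda> 0) a (F1 a a)"
        "\<And>y. y \<in> F1 a a \<Longrightarrow> near (\<Lambda> 0 + (\<Lambda> 0 + 1)) y {a}"
        using near_trans by blast+
      have "\<Lambda> 0 + 1 + \<Lambda> 0 < k0" "\<Lambda> 0 + (\<Lambda> 0 + 1) < k0"
        by (simp_all add: k0_def)
      then show ?thesis
        using near near_imp_nbhd by (intro hausdorff_distance_leI[OF k0]) blast+
    qed
    show "F1 a c \<subseteq> nbhd (\<Lambda> R) (F1 a b)" if "0 \<le> R" "c \<in> nbhd R (F1 a b)" for a b c R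
      using fill that unfolding coarse_1_filling_def by blast
    show "nbhd t (F1 a b) \<inter> nbhd t (F1 c b) \<inter> nbhd t (F1 a c) \<noteq> {}" for a b c
      using CM1[of c b a] unfolding lam0 by blast
    show "mono_on {t..} (\<lambda>R. \<Psi> (dl R) (D R))"
    proof (rule mono_onI)
      fix R R' assume R: "R \<in> {t..}" "R' \<in> {t..}" "R \<le> R'"
      have "\<Psi> (dl R) (D R) \<le> \<Psi> (dl R') (D R)"
        using R by (intro mono_onD[OF mono1]) (auto simp: dl dl_mono)
      also have "\<dots> \<le> \<Psi> (dl R') (D R')"
        using R by (intro mono_onD[OF mono2]) (auto simp: dl dl_mono)
      finally show "\<Psi> (dl R) (D R) \<le> \<Psi> (dl R') (D R')" .
    qed
    show "ediameter (nbhd R (F1 a b) \<inter> nbhd R (F1 c b) \<inter> nbhd R (F1 a c)) \<le> ennreal (\<Psi> (dl R) (D R))"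
      if R: "t \<le> R" for a b c R
    proof -
      \<comment> \<open>In the order \<open>a\<close>, \<open>c\<close>, \<open>b\<close> the sides
        are \<open>F1 c b\<close>, \<open>F1 a b\<close>, \<open>F1 a c\<close>, as the interval
        axiom requires, so nothing has to be reversed.\<close>
      have "generic_triple F0 F1 (dl R) (D R) a c b"
        using dl(1)[OF R] \<delta>0 by (intro generic_tripleI[OF fill]) (auto simp: D_def)
      from CM2[OF dl(1)[OF R] dl(3)[OF R] this] show ?thesis
        unfolding dl(2)[OF R] by (simp add: Int_ac)
    qed
  qed (use fill t \<Psi>0 dl in \<open>auto simp: coarse_1_filling_def\<close>)
  moreover have "affine_interval_parameters k0 t \<Lambda> (\<lambda>R. \<Psi> (dl R) (D R))"
    unfolding affine_interval_parameters_def
  proof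
    show "affine_function_on {0..} \<Lambda>"
      using aff unfolding affine_1_median_parameters_def by blast
    have "\<Psi> (dl R) (D R) = (B + 2 * C) / s * R + ((B + 2 * C) * (\<delta>0 - t / s) + 2 * C * (\<Lambda> 0 + 1) + E)"
      if "t \<le> R" for R
    proof -
      have "\<Psi> (dl R) (D R) = (B + 2 * C) * dl R + 2 * C * (\<Lambda> 0 + 1) + E"
        unfolding BCE[OF dl(1,3)[OF that]] by (simp add: D_def algebra_simps)
      moreover have "(B + 2 * C) * dl R = (B + 2 * C) / s * R + (B + 2 * C) * (\<delta>0 - t / s)"
        using s by (simp add: dl_def field_simps)
      ultimately show ?thesis
        by simp
    qed
    then show "affine_function_on {t..} (\<lambda>R. \<Psi> (dl R) (D R))"
      unfolding affine_function_on_def by (metis atLeast_iff)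
  qed
  ultimately show ?thesis
    by blast
qed

theorem proposition7p4:
  shows "((\<exists>\<mu> :: 'a::metric_space \<Rightarrow> 'a \<Rightarrow> 'a \<Rightarrow> 'a. bowditch_coarse_median \<mu>) \<longleftrightarrow>
          (\<exists>(I :: 'a \<Rightarrow> 'a \<Rightarrow> 'a set) k0 k1 \<Phi> \<Psi>.
             coarse_interval_structure I k0 k1 \<Phi> \<Psi> \<and> affine_interval_parameters k0 k1 \<Phi> \<Psi>)) \<and>
         ((\<exists>(I :: 'a \<Rightarrow> 'a \<Rightarrow> 'a set) k0 k1 \<Phi> \<Psi>.
             coarse_interval_structure I k0 k1 \<Phi> \<Psi> \<and> affine_interval_parameters k0 k1 \<Phi> \<Psi>) \<longleftrightarrow>
          (\<exists>(F0 :: 'a \<Rightarrow> 'a set) (F1 :: 'a \<Rightarrow> 'a \<Rightarrow> 'a set) \<Lambda> \<delta>0 lam \<Psi>.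
             coarse_1_median_structure F0 F1 \<Lambda> \<delta>0 lam \<Psi> \<and> affine_1_median_parameters \<Lambda> \<delta>0 \<Psi>))"
    (is "(?median \<longleftrightarrow> ?intervals) \<and> (_ \<longleftrightarrow> ?one_median)")
proof -
  have "?one_median" if ?median
    using that bowditch_imp_four_point four_point_coarse_median.coarse_1_median by blast
  moreover have "?intervals" if ?one_median
    using that coarse_1_median_imp_intervals by blast
  moreover have "?median" if ?intervals
    using that affine_intervals_imp_coarse_median_intervals coarse_median_intervals.bowditch by blast
  ultimately show ?thesis
    by blast
qed

end
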